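(* Let $X$ be a compact metric space with a reference Borel probability measure $\mu$, and let $\Lambda$ be a Baire space of continuous self-maps of $X$ endowed with a topology finer than the $C^0$-topology. Assume that there exists a dense set $D\subset\Lambda$ such that $\mathcal M_{\Lambda,f}=\mathcal M_1(f)$ for every $f\in D$. Then a Baire generic $g\in\Lambda$ has maximal oscillation, i.e. for $\mu$-almost every $x\in X$ the sequence of empirical measures $\{e_n^g(x)\}_n$ accumulates to every measure in $\mathcal M_1(g)$.
   Context: $\mathcal M_1(Y)$ denotes the space of Borel probability measures on a compact metric space $Y$ with the weak-$*$ topology; $\mathcal M_1(f)$ is the set of $f$-invariant Borel probability measures on $X$. For $f:X\to X$, $e_n^f(x)=\frac1n\sum_{i=0}^{n-1}\delta_{f^i(x)}\in\mathcal M_1(X)$ and $\hat e_n(f):=(e_n^f)_*\mu\in\mathcal M_1(\mathcal M_1(X))$. A map $f\in\Lambda$ statistically bifurcates toward $\hat\nu\in\mathcal M_1(\mathcal M_1(X))$ through perturbations in $\Lambda$ if there are a sequence $\{f_k\}_k$ in $\Lambda$ converging to $f$ and natural numbers $n_k\to\infty$ such that $\hat e_{n_k}(f_k)\to\hat\nu$. $\mathcal B_{\Lambda,f}$ is the set of all such $\hat\nu$, and $\mathcal M_{\Lambda,f}:=\{\nu\in\mathcal M_1(X)\mid \delta_\nu\in\mathcal B_{\Lambda,f}\}$, where $\delta_\nu$ is the Dirac mass at the point $\nu\in\mathcal M_1(X)$. Baire generic means: for all elements of a set containing a countable intersection of open dense subsets of $\Lambda$. *)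

theory Defs
  imports "HOL-Probability.Probability"
begin

section \<open>Borel probability measures with the weak-* topology\<close>

definition borel_of :: "'a topology \<Rightarrow> 'a measure" where
  "borel_of T = sigma (topspace T) {U. openin T U}"

text \<open>Abstract topologies are used so that the construction can be iterated:
  the points of \<open>weak_star (weak_star T)\<close> are Borel probability measures on the
  space of Borel probability measures on \<open>T\<close>.\<close>

definition prob_measures :: "'a topology \<Rightarrow> 'a measure set" where
  "prob_measures T = {m. prob_space m \<and> space m = topspace T \<and> sets m = sets (borel_of T)}"

text \<open>The coarsest topology making \<open>m \<mapsto> \<integral>\<phi> dm\<close> continuous for every continuous real
  function \<open>\<phi>\<close>. Meant for compact \<open>T\<close>, where each such \<open>\<phi>\<close> is bounded, hence integrable.\<close>

definition weak_star :: "'a topology \<Rightarrow> 'a measure topology" where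
  "weak_star T = topology_generated_by
     {{m \<in> prob_measures T. (\<integral>y. \<phi> y \<partial>m) \<in> U} | \<phi> U.
        continuous_map T euclideanreal \<phi> \<and> open U}"

definition invariant_measures :: "('a::topological_space \<Rightarrow> 'a) \<Rightarrow> 'a measure set" where
  "invariant_measures f = {m \<in> prob_measures euclidean. distr m borel f = m}"


section \<open>Empirical measures\<close>

text \<open>For \<open>n = 0\<close> this is the zero measure. This is harmless: below, only the behaviour
  as \<open>n\<close> tends to infinity matters.\<close>

definition empirical ::
    "('a::topological_space \<Rightarrow> 'a) \<Rightarrow> nat \<Rightarrow> 'a \<Rightarrow> 'a measure" where
  "empirical f n x = measure_of UNIV (sets borel)
     (\<lambda>A. (\<Sum>i<n. emeasure (return borel ((f ^^ i) x)) A) / of_nat n)"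

definition empirical_law ::
    "'a::topological_space measure \<Rightarrow> ('a \<Rightarrow> 'a) \<Rightarrow> nat \<Rightarrow> 'a measure measure" where
  "empirical_law \<mu> f n = distr \<mu> (borel_of (weak_star euclidean)) (empirical f n)"

text \<open>A sequence accumulates to a point if every neighbourhood of the point contains
  infinitely many of its terms.\<close>

definition accumulates_to :: "'b topology \<Rightarrow> (nat \<Rightarrow> 'b) \<Rightarrow> 'b \<Rightarrow> bool" where
  "accumulates_to T s l \<longleftrightarrow>
     l \<in> topspace T \<and> (\<forall>U. openin T U \<and> l \<in> U \<longrightarrow> (\<exists>\<^sub>F n in sequentially. s n \<in> U))"

definition maximal_oscillation ::
    "'a::topological_space measure \<Rightarrow> ('a \<Rightarrow> 'a) \<Rightarrow> bool" where
  "maximal_oscillation \<mu> g \<longleftrightarrow>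
     (AE x in \<mu>. \<forall>\<nu> \<in> invariant_measures g.
        accumulates_to (weak_star euclidean) (\<lambda>n. empirical g n x) \<nu>)"


section \<open>Spaces of maps\<close>

text \<open>On a compact metric space every continuous self-map is bounded, so the type
  \<open>'a \<Rightarrow>\<^sub>C 'a\<close> consists of all continuous self-maps, and its sup metric induces the
  \<open>C\<^sup>0\<close>-topology. A space of maps is a topology \<open>\<Lambda>\<close> on a subset \<open>topspace \<Lambda>\<close> of this type.\<close>

definition finer_than_C0 :: "('a::metric_space \<Rightarrow>\<^sub>C 'a) topology \<Rightarrow> bool" where
  "finer_than_C0 \<Lambda> \<longleftrightarrow> (\<forall>U. open U \<longrightarrow> openin \<Lambda> (U \<inter> topspace \<Lambda>))"

definition dense_in :: "'b topology \<Rightarrow> 'b set \<Rightarrow> bool" where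
  "dense_in T S \<longleftrightarrow> S \<subseteq> topspace T \<and> T closure_of S = topspace T"

definition Baire_space :: "'b topology \<Rightarrow> bool" where
  "Baire_space T \<longleftrightarrow>
     (\<forall>U :: nat \<Rightarrow> 'b set. (\<forall>n. openin T (U n) \<and> dense_in T (U n)) \<longrightarrow> dense_in T (\<Inter>n. U n))"

definition Baire_generic :: "'b topology \<Rightarrow> ('b \<Rightarrow> bool) \<Rightarrow> bool" where
  "Baire_generic T P \<longleftrightarrow>
     (\<exists>U :: nat \<Rightarrow> 'b set. (\<forall>n. openin T (U n) \<and> dense_in T (U n)) \<and> (\<forall>g \<in> (\<Inter>n. U n). P g))"


section \<open>Statistical bifurcation\<close>

definition bifurcates_toward ::
    "'a::metric_space measure \<Rightarrow> ('a \<Rightarrow>\<^sub>C 'a) topology \<Rightarrow> ('a \<Rightarrow>\<^sub>C 'a) \<Rightarrow> 'a measure measure \<Rightarrow> bool"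
  where
  "bifurcates_toward \<mu> \<Lambda> f \<nu>' \<longleftrightarrow>
     (\<exists>(F :: nat \<Rightarrow> 'a \<Rightarrow>\<^sub>C 'a) (n :: nat \<Rightarrow> nat).
        (\<forall>k. F k \<in> topspace \<Lambda>) \<and> limitin \<Lambda> F f sequentially \<and>
        filterlim n at_top sequentially \<and>
        limitin (weak_star (weak_star euclidean))
          (\<lambda>k. empirical_law \<mu> (apply_bcontfun (F k)) (n k)) \<nu>' sequentially)"

definition bifurcation_set ::
    "'a::metric_space measure \<Rightarrow> ('a \<Rightarrow>\<^sub>C 'a) topology \<Rightarrow> ('a \<Rightarrow>\<^sub>C 'a) \<Rightarrow> 'a measure measure set"
  where
  "bifurcation_set \<mu> \<Lambda> f =
     {\<nu>' \<in> prob_measures (weak_star euclidean). bifurcates_toward \<mu> \<Lambda> f \<nu>'}"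

definition bifurcation_measures ::
    "'a::metric_space measure \<Rightarrow> ('a \<Rightarrow>\<^sub>C 'a) topology \<Rightarrow> ('a \<Rightarrow>\<^sub>C 'a) \<Rightarrow> 'a measure set"
  where
  "bifurcation_measures \<mu> \<Lambda> f =
     {\<nu> \<in> prob_measures euclidean.
        return (borel_of (weak_star euclidean)) \<nu> \<in> bifurcation_set \<mu> \<Lambda> f}"


section \<open>Basic facts\<close>

lemma space_borel_of [simp]: "space (borel_of T) = topspace T"
  unfolding borel_of_def by (rule space_measure_of) (auto dest: openin_subset)

lemma sets_borel_of: "sets (borel_of T) = sigma_sets (topspace T) {U. openin T U}"
  unfolding borel_of_def by (rule sets_measure_of) (auto dest: openin_subset)

lemma sets_borel_of_euclidean [simp]: "sets (borel_of euclidean) = sets borel"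
  by (simp add: sets_borel_of borel_def)

lemma prob_measures_euclidean:
  "prob_measures euclidean = {m. prob_space m \<and> sets m = sets borel}"
  by (auto simp: prob_measures_def dest: sets_eq_imp_space_eq)

lemma topspace_weak_star [simp]: "topspace (weak_star T) = prob_measures T"
proof -
  have "prob_measures T \<in> {{m \<in> prob_measures T. (\<integral>y. \<phi> y \<partial>m) \<in> U} | \<phi> U.
        continuous_map T euclideanreal \<phi> \<and> open U}"
    by (rule CollectI, rule exI[of _ "\<lambda>_. 0"], rule exI[of _ UNIV]) auto
  then show ?thesis
    unfolding weak_star_def topology_generated_by_topspace by blast
qed

lemma sets_empirical [simp]: "sets (empirical f n x) = sets borel"
  using sets.sigma_sets_eq[of borel] by (simp add: empirical_def sets_measure_of_conv)

lemma space_empirical [simp]: "space (empirical f n x) = UNIV"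
  unfolding empirical_def by (simp add: space_measure_of_conv)

lemma emeasure_empirical:
  assumes "A \<in> sets borel"
  shows "emeasure (empirical f n x) A =
    (\<Sum>i<n. emeasure (return borel ((f ^^ i) x)) A) / of_nat n"
  unfolding empirical_def
proof (rule emeasure_measure_of_sigma)
  show "sigma_algebra UNIV (sets (borel :: 'a measure))"
    using sets.sigma_algebra_axioms[of "borel :: 'a measure"] by simp
  show "positive (sets borel)
     (\<lambda>A. (\<Sum>i<n. emeasure (return borel ((f ^^ i) x)) A) / of_nat n)"
    by (simp add: positive_def)
  show "countably_additive (sets borel)
     (\<lambda>A. (\<Sum>i<n. emeasure (return borel ((f ^^ i) x)) A) / of_nat n)"
  proof (rule countably_additiveI)
    fix A :: "nat \<Rightarrow> 'a set"
    assume A: "range A \<subseteq> sets borel" "disjoint_family A"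
    have "(\<Sum>j. (\<Sum>i<n. emeasure (return borel ((f ^^ i) x)) (A j)) / of_nat n)
        = (\<Sum>i<n. \<Sum>j. emeasure (return borel ((f ^^ i) x)) (A j)) / of_nat n"
      by (simp add: suminf_sum divide_ennreal_def)
    also have "\<dots> = (\<Sum>i<n. emeasure (return borel ((f ^^ i) x)) (\<Union>j. A j)) / of_nat n"
      using A by (subst suminf_emeasure) auto
    finally show "(\<Sum>j. (\<Sum>i<n. emeasure (return borel ((f ^^ i) x)) (A j)) / of_nat n)
       = (\<Sum>i<n. emeasure (return borel ((f ^^ i) x)) (\<Union>j. A j)) / of_nat n" .
  qed
qed (use assms in auto)

lemma empirical_in_prob_measures:
  assumes "n > 0"
  shows "empirical f n x \<in> prob_measures euclidean"
proof -
  have "emeasure (empirical f n x) UNIV = 1"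
    using assms
    by (simp add: emeasure_empirical ennreal_divide_self ennreal_of_nat_eq_real_of_nat)
  then show ?thesis
    by (auto simp: prob_measures_euclidean intro!: prob_spaceI)
qed

end

theory Submission
  imports Defs
begin

text \<open>For test functions \<open>\<phi>\<^sub>0, \<phi>\<^sub>1, \<dots>\<close> separating probability measures, a rational vector \<open>l\<close>
  and \<open>\<delta> > 0\<close>, let \<open>A\<close> be the set of maps having an invariant measure whose first integrals are
  \<open>\<delta>\<close>-close to \<open>l\<close>, and \<open>Q\<close> the set of maps for which, at some late time, with probability close
  to 1 the empirical integrals are \<open>2\<delta>\<close>-close to \<open>l\<close>. By weak-* compactness \<open>A\<close> is closed in the
  \<open>C\<^sup>0\<close>-topology, and by Fatou's lemma \<open>Q\<close> is open. On an open subset of \<open>A\<close> the maps from \<open>D\<close> are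
  dense, and each of them bifurcates toward a measure near \<open>l\<close>, so \<open>Q\<close> is dense there. Hence
  \<open>Q \<union> - A\<close> is open and dense. A map in all of these sets has, for each invariant measure and each
  accuracy, almost every orbit close to that measure infinitely often.\<close>

section \<open>Compact metric spaces as continuous images of compact sets of reals\<close>

lemma compact_UNIV_dense_sequence:
  assumes "compact (UNIV :: 'a::metric_space set)"
  obtains d :: "nat \<Rightarrow> 'a::metric_space" where "\<And>x e. e > 0 \<Longrightarrow> \<exists>i. dist (d i) x < e"
proof -
  have "\<exists>k. finite k \<and> (UNIV :: 'a set) \<subseteq> (\<Union>x\<in>k. ball x (1 / real (Suc n)))" for n
    using assms unfolding compact_eq_totally_bounded by simp
  then obtain k where k: "\<And>n. finite (k n)"
    "\<And>n. (UNIV :: 'a set) \<subseteq> (\<Union>x\<in>k n. ball x (1 / real (Suc n)))"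
    by metis
  define S where "S = (\<Union>n. k n)"
  have S: "countable S" unfolding S_def using k(1) by (auto intro: countable_finite)
  have near: "\<exists>c\<in>S. dist c x < e" if "e > 0" for x e
  proof -
    obtain n where n: "1 / real (Suc n) < e"
      using \<open>e > 0\<close> nat_approx_posE by blast
    from k(2)[of n] obtain c where "c \<in> k n" "x \<in> ball c (1 / real (Suc n))" by blast
    with n show ?thesis unfolding S_def by (intro bexI[of _ c]) auto
  qed
  then have "S \<noteq> {}" using zero_less_one by blast
  then have "\<exists>i. from_nat_into S i = c" if "c \<in> S" for c
    using from_nat_into_surj[OF S that] by blast
  then show ?thesis
    using near by (intro that[of "from_nat_into S"]) metis
qed

text \<open>A dense point closer to \<open>x\<close> than to \<open>y\<close>, together with a
  rational between the two distances, separates them. The strictly opposite signs are what will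
  force the sign codes of distinct points to differ.\<close>

lemma compact_UNIV_separating_sequence:
  assumes "compact (UNIV :: 'a::metric_space set)"
  obtains \<psi> :: "nat \<Rightarrow> 'a::metric_space \<Rightarrow> real"
  where "\<And>i. continuous_on UNIV (\<psi> i)" "\<And>x y. x \<noteq> y \<Longrightarrow> \<exists>i. \<psi> i x < 0 \<and> \<psi> i y > 0"
proof -
  obtain d :: "nat \<Rightarrow> 'a" where d: "\<And>x e. e > 0 \<Longrightarrow> \<exists>i. dist (d i) x < e"
    using compact_UNIV_dense_sequence[OF assms] by blast
  define \<psi> where "\<psi> n x = dist (d (fst (from_nat n :: nat \<times> rat))) x
      - of_rat (snd (from_nat n :: nat \<times> rat))" for n x
  show ?thesis
  proof
    show "continuous_on UNIV (\<psi> i)" for i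
      unfolding \<psi>_def by (intro continuous_intros)
    fix x y :: 'a
    assume "x \<noteq> y"
    then obtain i where i: "dist (d i) x < dist x y / 2"
      using d[of "dist x y / 2" x] by auto
    have "dist x y \<le> dist (d i) x + dist (d i) y"
      by (metis dist_commute dist_triangle)
    with i have "dist (d i) x < dist (d i) y" by linarith
    then obtain q where "dist (d i) x < of_rat q" "of_rat q < dist (d i) y"
      using of_rat_dense by blast
    then show "\<exists>i. \<psi> i x < 0 \<and> \<psi> i y > 0"
      unfolding \<psi>_def by (intro exI[of _ "to_nat (i, q)"]) simp
  qed
qed

section \<open>Base-4 expansions with signed digits\<close>

lemma summable_base4:
  fixes b :: "nat \<Rightarrow> real"
  assumes "\<And>i. \<bar>b i\<bar> \<le> 1"
  shows "summable (\<lambda>i. b i / 4 ^ i)"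
proof (rule summable_comparison_test')
  show "summable (\<lambda>i. (1 / 4 :: real) ^ i)" by (rule summable_geometric) simp
  show "norm (b n / 4 ^ n) \<le> (1 / 4) ^ n" if "n \<ge> 0" for n
    using assms[of n] by (simp add: power_divide field_simps)
qed

lemma base4_step:
  fixes b :: "nat \<Rightarrow> real"
  assumes "\<And>i. \<bar>b i\<bar> \<le> 1"
  shows "(\<Sum>i. b i / 4 ^ i) = b 0 + (\<Sum>i. b (Suc i) / 4 ^ i) / 4"
proof -
  have "(\<Sum>i. b i / 4 ^ i) = b 0 + (\<Sum>i. b (Suc i) / 4 ^ Suc i)"
    using suminf_split_head[OF summable_base4[of b, OF assms]] by simp
  also have "(\<Sum>i. b (Suc i) / 4 ^ Suc i) = (\<Sum>i. b (Suc i) / 4 ^ i / 4)" 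
    by (simp add: field_simps)
  also have "\<dots> = (\<Sum>i. b (Suc i) / 4 ^ i) / 4"
    using suminf_divide[OF summable_base4[of "\<lambda>i. b (Suc i)"], of 4] assms by simp
  finally show ?thesis .
qed

lemma abs_base4_le:
  fixes b :: "nat \<Rightarrow> real"
  assumes "\<And>i. \<bar>b i\<bar> \<le> 1"
  shows "\<bar>\<Sum>i. b i / 4 ^ i\<bar> \<le> 4 / 3"
proof -
  have g: "(\<lambda>i. (1 / 4 :: real) ^ i) sums (4 / 3)"
    using geometric_sums[of "1 / 4 :: real"] by simp
  have "norm (\<Sum>i. b i / 4 ^ i) \<le> (\<Sum>i. (1 / 4 :: real) ^ i)"
  proof (rule norm_suminf_le)
    show "norm (b n / 4 ^ n) \<le> (1 / 4) ^ n" for n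
      using assms[of n] by (simp add: power_divide field_simps)
  qed (use g in \<open>simp add: sums_iff\<close>)
  with g show ?thesis by (simp add: sums_iff)
qed

text \<open>Different leading digits differ by 2, while the tails, each at most 4/3 in absolute
  value and divided by 4, compensate at most 2/3. So the leading digits agree, hence the tails
  agree, and the induction continues with the shifted sequences.\<close>

lemma base4_inj:
  fixes b b' :: "nat \<Rightarrow> real"
  assumes "\<And>i. b i \<in> {-1, 1}" "\<And>i. b' i \<in> {-1, 1}"
    and "(\<Sum>i. b i / 4 ^ i) = (\<Sum>i. b' i / 4 ^ i)"
  shows "b n = b' n"
  using assms
proof (induction n arbitrary: b b')
  have abs: "\<bar>b i\<bar> \<le> 1" if "\<And>i. b i \<in> {-1, 1}" for b :: "nat \<Rightarrow> real" and i
    using that[of i] by auto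
  have eq: "b 0 = b' 0 \<and> (\<Sum>i. b (Suc i) / 4 ^ i) = (\<Sum>i. b' (Suc i) / 4 ^ i)"
    if B: "\<And>i. b i \<in> {-1, 1}" "\<And>i. b' i \<in> {-1, 1}" "(\<Sum>i. b i / 4 ^ i) = (\<Sum>i. b' i / 4 ^ i)"
    for b b' :: "nat \<Rightarrow> real"
  proof -
    have *: "\<bar>\<Sum>i. b (Suc i) / 4 ^ i\<bar> \<le> 4 / 3" "\<bar>\<Sum>i. b' (Suc i) / 4 ^ i\<bar> \<le> 4 / 3"
      using abs[of b, OF B(1)] abs[of b', OF B(2)] by (intro abs_base4_le; blast)+
    have "b 0 + (\<Sum>i. b (Suc i) / 4 ^ i) / 4 = b' 0 + (\<Sum>i. b' (Suc i) / 4 ^ i) / 4"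
      using base4_step[of b] base4_step[of b'] abs[of b, OF B(1)] abs[of b', OF B(2)] B(3) by metis
    moreover from this * B(1)[of 0] B(2)[of 0] have "b 0 = b' 0"
      by auto
    ultimately show ?thesis by simp
  qed
  {
    case 0
    show ?case using eq[OF 0] by blast
  next
    case (Suc n)
    show ?case
      using Suc.IH[of "\<lambda>i. b (Suc i)" "\<lambda>i. b' (Suc i)"] eq[OF Suc.prems] Suc.prems(1,2)
      by blast
  }
qed

text \<open>Partial sums depend on finitely many coordinates, so they are continuous in the product
  topology; the geometric bound makes them converge uniformly.\<close>

lemma continuous_on_base4:
  assumes "\<And>b i. b \<in> S \<Longrightarrow> \<bar>b i\<bar> \<le> 1"
  shows "continuous_on S (\<lambda>b :: nat \<Rightarrow> real. \<Sum>i. b i / 4 ^ i)"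
proof (rule uniform_limit_theorem)
  show "uniform_limit S (\<lambda>n b. \<Sum>i<n. b i / 4 ^ i) (\<lambda>b. \<Sum>i. b i / 4 ^ i) sequentially"
  proof (rule Weierstrass_m_test)
    show "summable (\<lambda>i. (1 / 4 :: real) ^ i)" by (rule summable_geometric) simp
    show "norm (b n / 4 ^ n) \<le> (1 / 4) ^ n" if "b \<in> S" for n b
      using assms[OF that, of n] by (simp add: power_divide field_simps)
  qed
  show "\<forall>\<^sub>F n in sequentially. continuous_on S (\<lambda>b. \<Sum>i<n. b i / 4 ^ i)"
    by (intro always_eventually allI continuous_intros
        continuous_on_subset[OF continuous_on_product_coordinates]) auto
qed simp

text \<open>On a compact set, a continuous map to a Hausdorff space is closed, so \<open>p\<close>
  is a quotient map onto its image and \<open>q\<close> descends: the preimage of a closed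
  \<open>B\<close> under \<open>h\<close> is the image under \<open>p\<close> of the compact part of
  \<open>K\<close> that \<open>q\<close> sends into \<open>B\<close>.\<close>

lemma compact_factor_through:
  fixes p :: "'a::topological_space \<Rightarrow> 'b::t2_space" and q :: "'a \<Rightarrow> 'c::topological_space"
  assumes "compact K" "continuous_on K p" "continuous_on K q"
    and "\<And>k k'. k \<in> K \<Longrightarrow> k' \<in> K \<Longrightarrow> p k = p k' \<Longrightarrow> q k = q k'"
  shows "\<exists>h. continuous_on (p ` K) h \<and> (\<forall>k\<in>K. h (p k) = q k)"
proof -
  define h where "h t = q (SOME k. k \<in> K \<and> p k = t)" for t
  have h: "h (p k) = q k" if "k \<in> K" for k
  proof -
    have "(SOME k'. k' \<in> K \<and> p k' = p k) \<in> K \<and> p (SOME k'. k' \<in> K \<and> p k' = p k) = p k"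
      by (rule someI[of _ k]) (use that in simp)
    then show ?thesis unfolding h_def using assms(4) that by blast
  qed
  have "continuous_on (p ` K) h"
    unfolding continuous_on_closed_invariant
  proof (intro allI impI)
    fix B :: "'c set" assume "closed B"
    obtain A where A: "closed A" "A \<inter> K = q -` B \<inter> K"
      using assms(3) \<open>closed B\<close> unfolding continuous_on_closed_invariant by blast
    have "compact (p ` (K \<inter> A))"
      using assms(1,2) A(1)
      by (intro compact_continuous_image compact_Int_closed) (auto intro: continuous_on_subset)
    moreover have "p ` (K \<inter> A) \<inter> p ` K = h -` B \<inter> p ` K"
      using A(2) h by fastforce
    ultimately show "\<exists>A. closed A \<and> A \<inter> p ` K = h -` B \<inter> p ` K"
      using compact_imp_closed by blast
  qed
  with h show ?thesis by blast
qed

text \<open>A point is coded by the signs of countably many separating functions, with both signs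
  allowed at a zero; this makes the set of codes compact.\<close>

lemma compact_Borel_section:
  assumes "compact (UNIV :: 'a::metric_space set)"
  obtains C :: "real set" and h :: "real \<Rightarrow> 'a::metric_space" and s :: "'a \<Rightarrow> real"
  where "compact C" "continuous_on C h" "s \<in> borel_measurable borel"
    "\<And>x. s x \<in> C" "\<And>x. h (s x) = x"
proof -
  obtain \<psi> :: "nat \<Rightarrow> 'a \<Rightarrow> real"
    where \<psi>: "\<And>i. continuous_on UNIV (\<psi> i)" "\<And>x y. x \<noteq> y \<Longrightarrow> \<exists>i. \<psi> i x < 0 \<and> \<psi> i y > 0"
    using compact_UNIV_separating_sequence[OF assms] by blast
  define K where "K = (PiE UNIV (\<lambda>_. {-1, 1 :: real}) \<times> (UNIV :: 'a set))
      \<inter> (\<Inter>i. {p. fst p i * \<psi> i (snd p) \<ge> 0})"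
  define c where "c b = (\<Sum>i. b i / 4 ^ i)" for b :: "nat \<Rightarrow> real"
  define p where "p k = c (fst k)" for k :: "(nat \<Rightarrow> real) \<times> 'a"
  have K: "b i \<in> {-1, 1}" "b i * \<psi> i x \<ge> 0" if "(b, x) \<in> K" for b x i
    using that by (auto simp: K_def PiE_iff)
  have digit: "continuous_on A (\<lambda>p :: (nat \<Rightarrow> real) \<times> 'a. fst p i)" for A i
    by (rule continuous_on_compose2[OF continuous_on_product_coordinates[of i]
        continuous_on_fst[OF continuous_on_id]]) simp
  have "compact (PiE UNIV (\<lambda>_. {-1, 1 :: real}) :: (nat \<Rightarrow> real) set)"
    using compactin_PiE[of "\<lambda>_. euclideanreal" "UNIV :: nat set" "\<lambda>_. {-1, 1}"]
    by (simp add: euclidean_product_topology)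
  moreover have "closed {p :: (nat \<Rightarrow> real) \<times> 'a. fst p i * \<psi> i (snd p) \<ge> 0}" for i
    by (intro closed_Collect_le continuous_on_const continuous_on_mult digit
        continuous_on_compose2[OF \<psi>(1) continuous_on_snd[OF continuous_on_id]] subset_UNIV)
  ultimately have compact: "compact K"
    unfolding K_def using assms by (intro compact_Int_closed compact_Times closed_INT) auto
  have pcont: "continuous_on K p"
    unfolding p_def c_def
  proof (rule continuous_on_compose2[OF continuous_on_base4 continuous_on_fst[OF continuous_on_id]])
    fix b i assume "b \<in> fst ` K"
    then obtain x where "(b, x) \<in> K" by auto
    then show "\<bar>b i\<bar> \<le> 1" using K(1)[of b x i] by auto
  qed simp
  \<comment> \<open>Equal real codes have equal digits, whereas a function strictly separating
    \<open>x\<close> from \<open>x'\<close> would force opposite digits. So the code determines the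
    point, even though a point may have several codes.\<close>
  have psnd: "snd k = snd k'" if k: "k \<in> K" "k' \<in> K" "p k = p k'" for k k'
  proof (rule ccontr)
    obtain b x b' x' where kk: "k = (b, x)" "k' = (b', x')" by (cases k, cases k')
    assume "snd k \<noteq> snd k'"
    then have "x \<noteq> x'" by (simp add: kk)
    then obtain i where i: "\<psi> i x < 0" "\<psi> i x' > 0" using \<psi>(2) by blast
    have K1: "(b, x) \<in> K" and K2: "(b', x') \<in> K" using k kk by simp_all
    have "b i = b' i"
      using k(3) K(1)[OF K1] K(1)[OF K2] unfolding kk p_def c_def fst_conv by (rule base4_inj[rotated 2])
    moreover have "b i = -1"
      using K[OF K1, of i] i(1) by auto
    moreover have "b' i = 1"
      using K[OF K2, of i] i(2) by auto
    ultimately show False by simp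
  qed
  obtain h where h: "continuous_on (p ` K) h" "\<And>k. k \<in> K \<Longrightarrow> h (p k) = snd k"
    using compact_factor_through[OF compact pcont continuous_on_snd[OF continuous_on_id]] psnd
    by blast
  \<comment> \<open>Taking 1 at zeros selects one code per point; the selection is Borel in
    \<open>x\<close>, which suffices for pushing measures forward.\<close>
  define b where "b x i = (if \<psi> i x \<ge> 0 then 1 else -1 :: real)" for x i
  have bK: "(b x, x) \<in> K" for x
    by (simp add: K_def b_def PiE_iff)
  show ?thesis
  proof (rule that[of "p ` K" h "\<lambda>x. p (b x, x)"])
    show "compact (p ` K)" by (rule compact_continuous_image[OF pcont compact])
    have [measurable]: "\<psi> i \<in> borel_measurable borel" for i
      using \<psi>(1) by (rule borel_measurable_continuous_onI)
    show "(\<lambda>x. p (b x, x)) \<in> borel_measurable borel"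
      unfolding p_def c_def b_def by simp
    show "continuous_on (p ` K) h" by (rule h(1))
    show "p (b x, x) \<in> p ` K" for x using bK by (rule imageI)
    show "h (p (b x, x)) = x" for x using h(2)[OF bK] by simp
  qed
qed

section \<open>Weak compactness of probability measures\<close>

lemma prob_measures_euclideanD:
  assumes "m \<in> prob_measures euclidean"
  shows "prob_space m" "sets m = sets borel" "space m = UNIV"
  using assms by (auto simp: prob_measures_def)

lemma integrable_prob_measures_euclidean:
  fixes \<phi> :: "'a::metric_space \<Rightarrow> real"
  assumes "compact (UNIV :: 'a set)" "m \<in> prob_measures euclidean" "continuous_on UNIV \<phi>"
  shows "integrable m \<phi>"
proof -
  interpret prob_space m using prob_measures_euclideanD[OF assms(2)] by simp
  have "bounded (range \<phi>)"
    using compact_continuous_image[OF assms(3,1)] by (rule compact_imp_bounded)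
  then obtain B where "\<And>x. norm (\<phi> x) \<le> B" unfolding bounded_iff by auto
  moreover have "\<phi> \<in> borel_measurable m"
    using borel_measurable_continuous_onI[OF assms(3)]
    by (simp cong: measurable_cong_sets add: prob_measures_euclideanD(2)[OF assms(2)])
  ultimately show ?thesis by (intro integrable_const_bound[of _ B]) auto
qed

text \<open>The measures are moved to the real line by a Borel section of a continuous surjection from a
  compact set of reals, where Helly's selection theorem applies; Tietze's theorem transfers the
  test functions.\<close>

lemma weak_sequential_compactness:
  fixes \<nu> :: "nat \<Rightarrow> 'a::metric_space measure"
  assumes "compact (UNIV :: 'a set)" "\<And>k. \<nu> k \<in> prob_measures euclidean"
  obtains r \<nu>' where "strict_mono r" "\<nu>' \<in> prob_measures euclidean"
    "\<And>\<phi> :: 'a \<Rightarrow> real. continuous_on UNIV \<phi> \<Longrightarrow>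
       (\<lambda>k. \<integral>x. \<phi> x \<partial>\<nu> (r k)) \<longlonglongrightarrow> (\<integral>x. \<phi> x \<partial>\<nu>')"
proof -
  obtain C :: "real set" and h :: "real \<Rightarrow> 'a" and s :: "'a \<Rightarrow> real"
    where C: "compact C" "continuous_on C h" and s: "s \<in> borel_measurable borel"
      and sC: "\<And>x. s x \<in> C" and hs: "\<And>x. h (s x) = x"
    by (rule compact_Borel_section[OF assms(1)]) (rule that)
  have "C \<noteq> {}" using sC by blast
  note \<nu> = prob_measures_euclideanD[OF assms(2)]
  have s\<nu> [measurable]: "s \<in> borel_measurable (\<nu> k)" for k
    using s by (simp cong: measurable_cong_sets add: \<nu>(2))
  define N where "N k = distr (\<nu> k) borel s" for k
  have N: "real_distribution (N k)" for k
  proof -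
    interpret prob_space "\<nu> k" by (rule \<nu>(1))
    show ?thesis unfolding N_def by (rule real_distribution_distr) (rule s\<nu>)
  qed
  have intN: "(\<integral>t. \<Phi> t \<partial>N k) = (\<integral>x. \<Phi> (s x) \<partial>\<nu> k)"
    if "continuous_on UNIV \<Phi>" for \<Phi> :: "real \<Rightarrow> real" and k
    unfolding N_def
    by (rule integral_distr[OF s\<nu>]) (rule borel_measurable_continuous_onI[OF that])
  obtain B where B: "\<And>t. t \<in> C \<Longrightarrow> \<bar>t\<bar> \<le> B"
    using compact_imp_bounded[OF C(1)] unfolding bounded_iff by auto
  have "B \<ge> 0" using B[OF sC[of undefined]] by linarith
  \<comment> \<open>All image measures live on \<open>C\<close>, so one interval serves every
    \<open>k\<close>. The margin 1 makes the left inequality strict and the interval nondegenerate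
    even if \<open>B\<close> is 0.\<close>
  have full: "measure (N k) {-B-1<..B+1} = 1" for k
  proof -
    have "-B-1 < s x \<and> s x \<le> B+1" for x
      using B[OF sC[of x]] by linarith
    then have "s -` {-B-1<..B+1} \<inter> space (\<nu> k) = space (\<nu> k)" by auto
    then have "measure (N k) {-B-1<..B+1} = measure (\<nu> k) (space (\<nu> k))"
      unfolding N_def by (subst measure_distr) auto
    then show ?thesis using prob_space.prob_space[OF \<nu>(1)] by simp
  qed
  have "tight N"
    unfolding tight_def
  proof (intro conjI allI impI)
    fix e :: real assume "e > 0"
    then show "\<exists>a b. a < b \<and> (\<forall>n. 1 - e < measure (N n) {a<..b})"
      using full \<open>B \<ge> 0\<close> by (intro exI[of _ "-B-1"] exI[of _ "B+1"]) auto
  qed (rule N)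
  then obtain r M where r: "strict_mono (r :: nat \<Rightarrow> nat)" and M: "real_distribution M"
    and wconv: "weak_conv_m (N \<circ> id \<circ> r) M"
    using tight_imp_convergent_subsubsequence[OF _ strict_mono_id, of N] by blast
  interpret M: real_distribution M by fact
  have conv: "(\<lambda>k. \<integral>x. \<Phi> (s x) \<partial>\<nu> (r k)) \<longlonglongrightarrow> (\<integral>t. \<Phi> t \<partial>M)"
    if "continuous_on UNIV \<Phi>" "\<And>t. \<bar>\<Phi> t\<bar> \<le> b" for \<Phi> :: "real \<Rightarrow> real" and b
  proof -
    have "(\<lambda>k. integral\<^sup>L ((N \<circ> id \<circ> r) k) \<Phi>) \<longlonglongrightarrow> integral\<^sup>L M \<Phi>"
    proof (rule weak_conv_imp_integral_bdd_continuous_conv[OF _ M wconv, of _ b])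
      show "real_distribution ((N \<circ> id \<circ> r) k)" for k by (simp add: N)
      show "isCont \<Phi> t" for t
        using that(1) by (simp add: continuous_on_eq_continuous_at)
      show "norm (\<Phi> t) \<le> b" for t using that(2) by simp
    qed
    then show ?thesis using intN[OF that(1)] by simp
  qed
  \<comment> \<open>The truncated distance to \<open>C\<close> is bounded, continuous and zero at
    every \<open>s x\<close>, so its integral against the limit \<open>M\<close> is zero; being
    nonnegative, it vanishes almost everywhere.\<close>
  have "AE t in M. t \<in> C"
  proof -
    define \<Phi> where "\<Phi> t = min 1 (infdist t C)" for t
    have \<Phi>: "continuous_on UNIV \<Phi>" "\<bar>\<Phi> t\<bar> \<le> 1" "\<Phi> t \<ge> 0" for t
      unfolding \<Phi>_def using infdist_nonneg[of t C] by (auto intro!: continuous_intros)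
    have "(\<lambda>k. \<integral>x. \<Phi> (s x) \<partial>\<nu> (r k)) = (\<lambda>k. 0)"
      using sC by (simp add: \<Phi>_def)
    with conv[OF \<Phi>(1,2)] have "(\<integral>t. \<Phi> t \<partial>M) = 0"
      by (simp add: LIMSEQ_const_iff)
    moreover have "integrable M \<Phi>"
      using \<Phi>(2) borel_measurable_continuous_onI[OF \<Phi>(1)]
      by (intro M.integrable_const_bound[of _ 1]) auto
    ultimately have "AE t in M. \<Phi> t = 0"
      using integral_nonneg_eq_0_iff_AE[of M \<Phi>] \<Phi>(3) by simp
    then show ?thesis
    proof eventually_elim
      case (elim t)
      then show ?case
        using in_closed_iff_infdist_zero[OF compact_imp_closed[OF C(1)] \<open>C \<noteq> {}\<close>, of t]
        by (auto simp: \<Phi>_def min_def split: if_splits)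
    qed
  qed
  \<comment> \<open>The constant value off \<open>C\<close> affects only an \<open>M\<close>-null
    set and makes \<open>h'\<close> a Borel map on the whole line.\<close>
  define h' where "h' t = (if t \<in> C then h t else undefined)" for t
  have h' [measurable]: "h' \<in> borel_measurable M"
    using borel_measurable_continuous_on_if[of C h "\<lambda>_. undefined"] C compact_imp_closed[OF C(1)]
    unfolding h'_def[abs_def] by simp
  show ?thesis
  proof (rule that[OF r])
    show "distr M borel h' \<in> prob_measures euclidean"
      using M.prob_space_distr[OF h'] by (simp add: prob_measures_euclidean)
    fix \<phi> :: "'a \<Rightarrow> real" assume \<phi>: "continuous_on UNIV \<phi>"
    have "bounded (range \<phi>)"
      using compact_continuous_image[OF \<phi> assms(1)] by (rule compact_imp_bounded)
    then obtain b where b: "\<And>x. \<bar>\<phi> x\<bar> \<le> b" unfolding bounded_iff by auto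
    have "b \<ge> 0" using b[of undefined] by linarith
    have "continuous_on C (\<lambda>t. \<phi> (h t))"
      by (rule continuous_on_compose2[OF \<phi> C(2)]) simp
    \<comment> \<open>Weak convergence on the line is tested with bounded functions continuous
      everywhere, but the pulled-back \<open>\<phi>\<close> is continuous only on \<open>C\<close>;
      Tietze extends it with the same bound.\<close>
    then obtain \<Phi> where \<Phi>: "continuous_on UNIV \<Phi>" "\<And>t. t \<in> C \<Longrightarrow> \<Phi> t = \<phi> (h t)"
      "\<And>t. t \<in> UNIV \<Longrightarrow> norm (\<Phi> t) \<le> b"
      by (rule Tietze[of C "\<lambda>t. \<phi> (h t)" UNIV b])
        (use b \<open>b \<ge> 0\<close> compact_imp_closed[OF C(1)] in auto)
    have [measurable]: "\<Phi> \<in> borel_measurable borel" "\<phi> \<in> borel_measurable borel"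
      using \<Phi>(1) \<phi> by (auto intro: borel_measurable_continuous_onI)
    have "(\<integral>t. \<Phi> t \<partial>M) = (\<integral>t. \<phi> (h' t) \<partial>M)"
    proof (rule integral_cong_AE)
      show "AE t in M. \<Phi> t = \<phi> (h' t)"
        using \<open>AE t in M. t \<in> C\<close> by eventually_elim (simp add: \<Phi>(2) h'_def)
    qed measurable
    also have "\<dots> = (\<integral>x. \<phi> x \<partial>distr M borel h')"
      by (rule integral_distr[symmetric]) measurable
    finally show "(\<lambda>k. \<integral>x. \<phi> x \<partial>\<nu> (r k)) \<longlonglongrightarrow> (\<integral>x. \<phi> x \<partial>distr M borel h')"
      using conv[OF \<Phi>(1), of b] \<Phi>(3) by (simp add: \<Phi>(2) sC hs)
  qed
qed

section \<open>The weak-* topology\<close>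

text \<open>Every open set is a countable union of closed balls with centres in the dense sequence
  and rational radii. Finite intersections are taken to get an intersection-stable generator, for
  use in uniqueness of measures; the empty list gives the whole space.\<close>

lemma borel_eq_sigma_sets_cball:
  fixes d :: "nat \<Rightarrow> 'a::metric_space"
  assumes d: "\<And>x e. e > 0 \<Longrightarrow> \<exists>i. dist (d i) x < e"
  shows "sets (borel :: 'a measure) = sigma_sets UNIV
    (range (\<lambda>l :: (nat \<times> rat) list. \<Inter>p\<in>set l. cball (d (fst p)) (of_rat (snd p))))"
    (is "_ = sigma_sets UNIV ?E")
proof -
  have cball: "cball (d i) (of_rat q) \<in> sigma_sets UNIV ?E" for i q
    by (rule sigma_sets.Basic, rule range_eqI[of _ _ "[(i, q)]"]) simp
  have "U \<in> sigma_sets UNIV ?E" if "open U" for U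
  proof -
    define I where "I = {p :: nat \<times> rat. cball (d (fst p)) (of_rat (snd p)) \<subseteq> U}"
    have "\<exists>p\<in>I. x \<in> cball (d (fst p)) (of_rat (snd p))" if "x \<in> U" for x
    proof -
      obtain e where e: "e > 0" "ball x e \<subseteq> U"
        using \<open>open U\<close> \<open>x \<in> U\<close> open_contains_ball by blast
      obtain i where i: "dist (d i) x < e / 2" using d[of "e / 2" x] e by auto
      obtain q where q: "dist (d i) x < of_rat q" "of_rat q < e / 2"
        using of_rat_dense[OF i] by blast
      have "cball (d i) (of_rat q) \<subseteq> ball x e"
      proof
        fix y assume "y \<in> cball (d i) (of_rat q)"
        then show "y \<in> ball x e"
          using dist_triangle3[of x y "d i"] q i by auto
      qed
      then show ?thesis using e(2) q(1) unfolding I_def by (intro bexI[of _ "(i, q)"]) auto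
    qed
    then have "U = (\<Union>p\<in>I. cball (d (fst p)) (of_rat (snd p)))"
      unfolding I_def by blast
    moreover have "\<dots> \<in> sigma_sets UNIV ?E"
      using cball by (intro sigma_sets_UNION) auto
    ultimately show ?thesis by simp
  qed
  then have "sigma_sets UNIV {S. open S} \<subseteq> sigma_sets UNIV ?E"
    by (intro sigma_sets_mono) auto
  moreover have "?E \<subseteq> sets borel"
    by (auto intro!: borel_closed closed_INT)
  then have "sigma_sets UNIV ?E \<subseteq> sets borel"
    using sets.sigma_sets_subset[of ?E borel] by simp
  ultimately show ?thesis by (auto simp: borel_def)
qed

text \<open>The indicator of each finite intersection \<open>F l\<close> of balls is the pointwise
  limit of the continuous functions \<open>\<tau> l m\<close>. Equal integrals thus give equal
  measure to every \<open>F l\<close>, and these sets form an intersection-stable generator of the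
  Borel sets.\<close>

lemma prob_measures_separating_sequence:
  assumes "compact (UNIV :: 'a::metric_space set)"
  shows "\<exists>\<phi> :: nat \<Rightarrow> 'a \<Rightarrow> real. (\<forall>i. continuous_on UNIV (\<phi> i)) \<and>
    (\<forall>M\<in>prob_measures euclidean. \<forall>N\<in>prob_measures euclidean.
       (\<forall>i. (\<integral>x. \<phi> i x \<partial>M) = (\<integral>x. \<phi> i x \<partial>N)) \<longrightarrow> M = N)"
proof -
  obtain d :: "nat \<Rightarrow> 'a" where d: "\<And>x e. e > 0 \<Longrightarrow> \<exists>i. dist (d i) x < e"
    using compact_UNIV_dense_sequence[OF assms] by blast
  define F where "F l = (\<Inter>p\<in>set l. cball (d (fst p)) (of_rat (snd p)))"
    for l :: "(nat \<times> rat) list"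
  \<comment> \<open>\<open>\<sigma> l\<close> vanishes exactly on \<open>F l\<close>, so
    \<open>\<tau> l m\<close> is 1 there and, for large \<open>m\<close>, 0 at any given point
    outside.\<close>
  define \<sigma> where "\<sigma> l x = (\<Sum>p\<in>set l. max 0 (dist (d (fst p)) x - of_rat (snd p)))"
    for l :: "(nat \<times> rat) list" and x
  define \<tau> where "\<tau> l m x = max 0 (1 - real m * \<sigma> l x)" for l m x
  define \<phi> where "\<phi> n = (case from_nat n of (l, m) \<Rightarrow> \<tau> l m)" for n
  have \<sigma>: "\<sigma> l x \<ge> 0" for l x unfolding \<sigma>_def by (intro sum_nonneg) auto
  have cont: "continuous_on UNIV (\<tau> l m)" for l m
    unfolding \<tau>_def \<sigma>_def by (intro continuous_intros)
  have F: "F l \<in> sets borel" for l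
    unfolding F_def by (auto intro!: borel_closed closed_INT)
  have lim: "(\<lambda>m. \<integral>x. \<tau> l m x \<partial>M) \<longlonglongrightarrow> measure M (F l)"
    if M: "M \<in> prob_measures euclidean" for M l
  proof -
    interpret prob_space M using M by (simp add: prob_measures_def)
    have sets: "sets M = sets borel" using M by (simp add: prob_measures_euclidean)
    have "(\<lambda>m. \<integral>x. \<tau> l m x \<partial>M) \<longlonglongrightarrow> (\<integral>x. indicator (F l) x \<partial>M)"
    proof (rule integral_dominated_convergence[where w = "\<lambda>_. 1"])
      show "\<tau> l m \<in> borel_measurable M" for m
        using borel_measurable_continuous_onI[OF cont] by (simp cong: measurable_cong_sets add: sets)
      show "AE x in M. norm (\<tau> l m x) \<le> 1" for m
        using \<sigma> by (auto simp: \<tau>_def)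
      show "AE x in M. (\<lambda>m. \<tau> l m x) \<longlonglongrightarrow> indicator (F l) x"
      proof (rule AE_I2)
        fix x
        show "(\<lambda>m. \<tau> l m x) \<longlonglongrightarrow> indicator (F l) x"
        proof (cases "x \<in> F l")
          case True
          then have "\<sigma> l x = 0" unfolding F_def \<sigma>_def by (intro sum.neutral) auto
          with True show ?thesis by (simp add: \<tau>_def)
        next
          case False
          then obtain p where p: "p \<in> set l" "dist (d (fst p)) x > of_rat (snd p)"
            unfolding F_def by (auto simp: not_le)
          then have "max 0 (dist (d (fst p)) x - of_rat (snd p)) \<le> \<sigma> l x"
            unfolding \<sigma>_def by (intro member_le_sum) auto
          with p(2) have pos: "\<sigma> l x > 0" by simp
          then obtain m0 :: nat where m0: "1 < real m0 * \<sigma> l x"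
            using reals_Archimedean3 by blast
          have "\<forall>\<^sub>F m in sequentially. \<tau> l m x = 0"
            using eventually_ge_at_top[of m0]
          proof eventually_elim
            case (elim m)
            then have "real m0 * \<sigma> l x \<le> real m * \<sigma> l x" using pos by simp
            with m0 show ?case by (simp add: \<tau>_def)
          qed
          with False show ?thesis by (simp add: tendsto_eventually)
        qed
      qed
    qed (use F in \<open>auto simp: sets intro!: borel_measurable_indicator\<close>)
    also have "(\<integral>x. indicator (F l) x \<partial>M) = measure M (F l)"
      using F by (simp add: sets sets_eq_imp_space_eq[OF sets])
    finally show ?thesis .
  qed
  show ?thesis
  proof (intro exI[of _ \<phi>] conjI allI ballI impI)
    show "continuous_on UNIV (\<phi> i)" for i
      using cont by (simp add: \<phi>_def split: prod.split)
    fix M N :: "'a measure"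
    assume M: "M \<in> prob_measures euclidean" and N: "N \<in> prob_measures euclidean"
      and eq: "\<forall>i. (\<integral>x. \<phi> i x \<partial>M) = (\<integral>x. \<phi> i x \<partial>N)"
    interpret M: prob_space M using M by (simp add: prob_measures_def)
    interpret N: prob_space N using N by (simp add: prob_measures_def)
    have "(\<integral>x. \<tau> l m x \<partial>M) = (\<integral>x. \<tau> l m x \<partial>N)" for l m
      using eq[rule_format, of "to_nat (l, m)"] by (simp add: \<phi>_def)
    then have meas: "measure M (F l) = measure N (F l)" for l
      using lim[OF M, of l] lim[OF N, of l] LIMSEQ_unique by simp
    show "M = N"
    proof (rule measure_eqI_generator_eq[of "range F" UNIV M N "\<lambda>_. UNIV"])
      show "Int_stable (range F)"
      proof (rule Int_stableI_image)
        show "\<exists>k\<in>UNIV. F i \<inter> F j = F k" for i j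
          by (rule bexI[of _ "i @ j"]) (auto simp: F_def)
      qed
      show "sets M = sigma_sets UNIV (range F)" "sets N = sigma_sets UNIV (range F)"
        using borel_eq_sigma_sets_cball[of d, OF d] M N
        unfolding F_def[abs_def] by (simp_all add: prob_measures_euclidean)
      have "F [] = UNIV" by (simp add: F_def)
      then show "range (\<lambda>_. UNIV) \<subseteq> range F" by blast
    qed (auto simp: M.emeasure_eq_measure N.emeasure_eq_measure meas)
  qed
qed

section \<open>Continuity, convergence and neighbourhoods in the weak-* topology\<close>

lemma measurable_borel_of:
  assumes "continuous_map T1 T2 f" "space M = topspace T1" "sets M = sets (borel_of T1)"
  shows "f \<in> measurable M (borel_of T2)"
  unfolding borel_of_def
proof (rule measurable_measure_of)
  show "f \<in> space M \<rightarrow> topspace T2"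
    using continuous_map_image_subset_topspace[OF assms(1)] by (auto simp: assms(2))
  fix U assume "U \<in> {U. openin T2 U}"
  then have "openin T1 {x \<in> topspace T1. f x \<in> U}"
    using assms(1) by (auto intro: openin_continuous_map_preimage)
  also have "{x \<in> topspace T1. f x \<in> U} = f -` U \<inter> space M"
    by (auto simp: assms(2))
  finally show "f -` U \<inter> space M \<in> sets M"
    by (simp add: assms(3) sets_borel_of)
qed (auto dest: openin_subset)

text \<open>The topology \<open>T\<close> is arbitrary because this is applied both to measures on
  the base space and to measures on the space of measures.\<close>

lemma continuous_map_weak_star_integral:
  fixes \<phi> :: "'a \<Rightarrow> real"
  assumes "continuous_map T euclideanreal \<phi>"
  shows "continuous_map (weak_star T) euclideanreal (\<lambda>m. \<integral>y. \<phi> y \<partial>m)"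
  unfolding continuous_map_alt
proof (intro conjI allI impI)
  fix U :: "real set" assume "openin euclidean U"
  then have "openin (weak_star T) {m \<in> prob_measures T. (\<integral>y. \<phi> y \<partial>m) \<in> U}"
    using assms unfolding weak_star_def by (intro topology_generated_by_Basis) auto
  also have "{m \<in> prob_measures T. (\<integral>y. \<phi> y \<partial>m) \<in> U} =
      (\<lambda>m. \<integral>y. \<phi> y \<partial>m) -` U \<inter> topspace (weak_star T)"
    by auto
  finally show "openin (weak_star T) \<dots>" .
qed simp

text \<open>Test functions give eventual membership in the generating sets; induction over the
  generation of the topology carries it through finite intersections and arbitrary unions.\<close>

lemma limitin_weak_star_euclidean:
  fixes \<nu> :: "nat \<Rightarrow> 'a::topological_space measure"
  assumes "\<And>k. \<nu> k \<in> prob_measures euclidean" "\<nu>' \<in> prob_measures euclidean"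
    and "\<And>\<phi> :: 'a \<Rightarrow> real. continuous_on UNIV \<phi> \<Longrightarrow>
       (\<lambda>k. \<integral>x. \<phi> x \<partial>\<nu> k) \<longlonglongrightarrow> (\<integral>x. \<phi> x \<partial>\<nu>')"
  shows "limitin (weak_star euclidean) \<nu> \<nu>' sequentially"
  unfolding limitin_def
proof (intro conjI allI impI)
  show "\<nu>' \<in> topspace (weak_star euclidean)" using assms(2) by simp
  fix U :: "'a measure set" assume U: "openin (weak_star euclidean) U \<and> \<nu>' \<in> U"
  then have "generate_topology_on {{m \<in> prob_measures euclidean. (\<integral>y. \<phi> y \<partial>m) \<in> U} | \<phi> U.
        continuous_map euclidean euclideanreal \<phi> \<and> open U} U"
    unfolding weak_star_def by (simp add: openin_topology_generated_by)
  then have "\<nu>' \<in> U \<longrightarrow> (\<forall>\<^sub>F k in sequentially. \<nu> k \<in> U)"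
  proof (induction rule: generate_topology_on.induct)
    case (Int a b)
    then show ?case by (auto intro: eventually_conj)
  next
    case (UN K)
    show ?case
    proof
      assume "\<nu>' \<in> \<Union>K"
      then obtain k where "k \<in> K" "\<nu>' \<in> k" by blast
      with UN.IH have "\<forall>\<^sub>F j in sequentially. \<nu> j \<in> k" by blast
      then show "\<forall>\<^sub>F j in sequentially. \<nu> j \<in> \<Union>K"
        by eventually_elim (use \<open>k \<in> K\<close> in blast)
    qed
  next
    case (Basis s)
    then obtain \<phi> V where s: "s = {m \<in> prob_measures euclidean. (\<integral>y. \<phi> y \<partial>m) \<in> V}"
      and "continuous_map euclidean euclideanreal \<phi>" and V: "open V" by blast
    then have \<phi>: "continuous_on UNIV \<phi>" by simp
    show ?case
      using topological_tendstoD[OF assms(3)[OF \<phi>] V] assms(1) unfolding s by auto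
  qed simp
  with U show "\<forall>\<^sub>F k in sequentially. \<nu> k \<in> U" by blast
qed

text \<open>Otherwise, for each \<open>k\<close> some measure outside \<open>U\<close> has its first
  \<open>k\<close> integrals within 1/(k+1) of those of \<open>\<nu>\<close>. A subsequence
  converges weakly, its limit has all the integrals of \<open>\<nu>\<close> and so is
  \<open>\<nu>\<close> by \<open>sep\<close>, and the subsequence would have to enter
  \<open>U\<close>.\<close>

lemma weak_star_neighbourhood:
  fixes \<phi> :: "nat \<Rightarrow> 'a::metric_space \<Rightarrow> real"
  assumes "compact (UNIV :: 'a set)"
    and cont: "\<And>i. continuous_on UNIV (\<phi> i)"
    and sep: "\<forall>M\<in>prob_measures euclidean. \<forall>N\<in>prob_measures euclidean.
       (\<forall>i. (\<integral>x. \<phi> i x \<partial>M) = (\<integral>x. \<phi> i x \<partial>N)) \<longrightarrow> M = N"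
    and U: "openin (weak_star euclidean) U" "\<nu> \<in> U"
  obtains k where "\<And>m. m \<in> prob_measures euclidean \<Longrightarrow>
      (\<And>i. i < k \<Longrightarrow> \<bar>(\<integral>x. \<phi> i x \<partial>m) - (\<integral>x. \<phi> i x \<partial>\<nu>)\<bar> < 1 / real (Suc k)) \<Longrightarrow> m \<in> U"
proof (rule ccontr)
  assume neg: "\<not> thesis"
  have \<nu>: "\<nu> \<in> prob_measures euclidean"
    using openin_subset[OF U(1)] U(2) by auto
  have "\<exists>m. m \<in> prob_measures euclidean \<and>
      (\<forall>i<k. \<bar>(\<integral>x. \<phi> i x \<partial>m) - (\<integral>x. \<phi> i x \<partial>\<nu>)\<bar> < 1 / real (Suc k)) \<and> m \<notin> U" for k
    using neg that[of k] by blast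
  then obtain m where m: "\<And>k. m k \<in> prob_measures euclidean"
    "\<And>k i. i < k \<Longrightarrow> \<bar>(\<integral>x. \<phi> i x \<partial>m k) - (\<integral>x. \<phi> i x \<partial>\<nu>)\<bar> < 1 / real (Suc k)"
    "\<And>k. m k \<notin> U"
    by metis
  obtain r \<nu>' where r: "strict_mono r" and \<nu>': "\<nu>' \<in> prob_measures euclidean"
    and lim: "\<And>\<phi> :: 'a \<Rightarrow> real. continuous_on UNIV \<phi> \<Longrightarrow>
       (\<lambda>k. \<integral>x. \<phi> x \<partial>m (r k)) \<longlonglongrightarrow> (\<integral>x. \<phi> x \<partial>\<nu>')"
    by (rule weak_sequential_compactness[OF assms(1) m(1)]) (rule that)
  have "(\<integral>x. \<phi> i x \<partial>\<nu>') = (\<integral>x. \<phi> i x \<partial>\<nu>)" for i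
  proof -
    have "(\<lambda>k. (\<integral>x. \<phi> i x \<partial>m k)) \<longlonglongrightarrow> (\<integral>x. \<phi> i x \<partial>\<nu>)"
    proof (rule LIM_zero_cancel, rule tendsto_rabs_zero_cancel,
        rule tendsto_sandwich[of "\<lambda>_. 0" _ _ "\<lambda>k. 1 / real (Suc k)"])
      show "\<forall>\<^sub>F k in sequentially. \<bar>(\<integral>x. \<phi> i x \<partial>m k) - (\<integral>x. \<phi> i x \<partial>\<nu>)\<bar> \<le> 1 / real (Suc k)"
        using eventually_gt_at_top[of i] by eventually_elim (use m(2) in \<open>auto intro: less_imp_le\<close>)
      show "(\<lambda>k. 1 / real (Suc k)) \<longlonglongrightarrow> 0" by (rule LIMSEQ_Suc[OF lim_1_over_n])
    qed auto
    from LIMSEQ_subseq_LIMSEQ[OF this r] lim[OF cont, of i] show ?thesis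
      using LIMSEQ_unique by (auto simp: o_def)
  qed
  then have "\<nu>' = \<nu>" using sep \<nu>' \<nu> by blast
  then have "limitin (weak_star euclidean) (\<lambda>k. m (r k)) \<nu> sequentially"
    using limitin_weak_star_euclidean[of "\<lambda>k. m (r k)" \<nu>'] m(1) \<nu>' lim by simp
  with U have "\<forall>\<^sub>F k in sequentially. m (r k) \<in> U" by (simp add: limitin_def)
  with m(3) show False by simp
qed

section \<open>Empirical measures and invariant measures\<close>

text \<open>As an image of the uniform measure on \<open>{..<n}\<close>, the empirical measure turns
  integrals into finite averages by change of variables.\<close>

lemma empirical_eq_distr:
  assumes "n > 0"
  shows "empirical f n x = distr (uniform_count_measure {..<n}) borel (\<lambda>i. (f ^^ i) x)"
proof (rule measure_eqI)
  fix A assume "A \<in> sets (empirical f n x)"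
  then have A: "A \<in> sets borel" by simp
  define I where "I = {i \<in> {..<n}. (f ^^ i) x \<in> A}"
  have "emeasure (empirical f n x) A = (\<Sum>i<n. indicator A ((f ^^ i) x)) / of_nat n"
    using A by (simp add: emeasure_empirical)
  also have "(\<Sum>i<n. indicator A ((f ^^ i) x)) = (of_nat (card I) :: ennreal)"
    unfolding I_def by (simp add: indicator_def sum.If_cases Int_def)
  also have "of_nat (card I) / of_nat n = ennreal (card I / n)"
    using assms by (simp add: ennreal_of_nat_eq_real_of_nat divide_ennreal)
  also have "\<dots> = emeasure (uniform_count_measure {..<n}) I"
    by (subst emeasure_uniform_count_measure) (auto simp: I_def)
  also have "\<dots> = emeasure (distr (uniform_count_measure {..<n}) borel (\<lambda>i. (f ^^ i) x)) A"
    using A by (subst emeasure_distr)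
      (auto simp: I_def space_uniform_count_measure sets_uniform_count_measure measurable_def
        intro!: arg_cong[where f = "emeasure _"])
  finally show "emeasure (empirical f n x) A =
      emeasure (distr (uniform_count_measure {..<n}) borel (\<lambda>i. (f ^^ i) x)) A" .
qed simp

lemma integral_empirical:
  fixes \<phi> :: "'a::topological_space \<Rightarrow> real"
  assumes "n > 0" "continuous_on UNIV \<phi>"
  shows "(\<integral>y. \<phi> y \<partial>empirical f n x) = (\<Sum>i<n. \<phi> ((f ^^ i) x)) / real n"
proof -
  have "(\<integral>y. \<phi> y \<partial>empirical f n x) = (\<integral>i. \<phi> ((f ^^ i) x) \<partial>uniform_count_measure {..<n})"
    unfolding empirical_eq_distr[OF assms(1)]
    using borel_measurable_continuous_onI[OF assms(2)]
    by (intro integral_distr) (auto simp: measurable_def sets_uniform_count_measure space_uniform_count_measure)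
  then show ?thesis by (simp add: integral_uniform_count_measure)
qed

lemma continuous_on_funpow:
  fixes f :: "'a::topological_space \<Rightarrow> 'a"
  assumes "continuous_on UNIV f"
  shows "continuous_on UNIV (f ^^ i)"
proof (induction i)
  case (Suc i)
  then show ?case
    using continuous_on_compose2[OF assms Suc] by (simp add: o_def)
qed (simp add: id_def continuous_on_id)

lemma continuous_on_Birkhoff_average:
  fixes \<phi> :: "'a::topological_space \<Rightarrow> real" and f :: "'a \<Rightarrow> 'a"
  assumes "continuous_on UNIV f" "continuous_on UNIV \<phi>"
  shows "continuous_on UNIV (\<lambda>x. (\<Sum>i<n. \<phi> ((f ^^ i) x)) / real n)"
  unfolding divide_inverse
  by (intro continuous_on_sum continuous_on_mult continuous_on_const
      continuous_on_compose2[OF assms(2) continuous_on_funpow[OF assms(1)]]) auto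

text \<open>Preimages of the generating sets are conditions on Birkhoff averages, which are
  continuous. The resulting Borel measurability allows integrals against
  \<open>empirical_law\<close> to be computed by change of variables.\<close>

lemma continuous_map_empirical:
  fixes f :: "'a::topological_space \<Rightarrow> 'a"
  assumes "n > 0" "continuous_on UNIV f"
  shows "continuous_map euclidean (weak_star euclidean) (empirical f n)"
  unfolding weak_star_def
proof (rule continuous_on_generated_topo)
  fix W :: "'a measure set"
  assume "W \<in> {{m \<in> prob_measures euclidean. (\<integral>y. \<phi> y \<partial>m) \<in> U} | \<phi> U.
        continuous_map euclidean euclideanreal \<phi> \<and> open U}"
  then obtain \<phi> :: "'a \<Rightarrow> real" and U where W: "W = {m \<in> prob_measures euclidean. (\<integral>y. \<phi> y \<partial>m) \<in> U}"
    and \<phi>: "continuous_on UNIV \<phi>" and U: "open U" by auto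
  have "empirical f n -` W = (\<lambda>x. (\<Sum>i<n. \<phi> ((f ^^ i) x)) / real n) -` U"
    unfolding W using assms(1)
    by (auto simp: empirical_in_prob_measures integral_empirical[OF assms(1) \<phi>])
  moreover have "open \<dots>"
    using U continuous_on_Birkhoff_average[OF assms(2) \<phi>] by (rule open_vimage)
  ultimately show "openin euclidean (empirical f n -` W \<inter> topspace euclidean)" by simp
next
  have "\<Union>{{m \<in> prob_measures euclidean. (\<integral>y. \<phi> y \<partial>m) \<in> U} | \<phi> U.
        continuous_map euclidean euclideanreal \<phi> \<and> open U} = (prob_measures euclidean :: 'a measure set)"
    using topspace_weak_star[of "euclidean :: 'a topology"]
    unfolding weak_star_def topology_generated_by_topspace .
  then show "empirical f n ` topspace euclidean \<subseteq>
      \<Union>{{m \<in> prob_measures euclidean. (\<integral>y. \<phi> y \<partial>m) \<in> U} | \<phi> U.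
        continuous_map euclidean euclideanreal \<phi> \<and> open U}"
    using assms(1) by (auto simp: empirical_in_prob_measures)
qed

section \<open>Limits of invariant measures\<close>

lemma invariant_measures_prob: "\<nu> \<in> invariant_measures g \<Longrightarrow> \<nu> \<in> prob_measures euclidean"
  by (simp add: invariant_measures_def)

text \<open>Invariance of \<open>\<nu> k\<close> under \<open>G k\<close> rewrites its defect of
  invariance under \<open>g\<close>, tested on \<open>\<phi>\<close>, as the integral of the
  difference of \<open>\<phi> (g x)\<close> and \<open>\<phi> (G k x)\<close>. This tends to 0 by
  uniform continuity of \<open>\<phi>\<close> and uniform convergence of the maps. A separating
  sequence then identifies \<open>\<nu>'\<close> with its image under \<open>g\<close>.\<close>

lemma invariant_measures_limit:
  fixes g :: "'a::metric_space \<Rightarrow>\<^sub>C 'a"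
  assumes "compact (UNIV :: 'a set)" "G \<longlonglongrightarrow> g"
    and \<nu>: "\<And>k. \<nu> k \<in> invariant_measures (apply_bcontfun (G k))"
    and \<nu>': "\<nu>' \<in> prob_measures euclidean"
    and lim: "\<And>\<phi> :: 'a \<Rightarrow> real. continuous_on UNIV \<phi> \<Longrightarrow>
       (\<lambda>k. \<integral>x. \<phi> x \<partial>\<nu> k) \<longlonglongrightarrow> (\<integral>x. \<phi> x \<partial>\<nu>')"
  shows "\<nu>' \<in> invariant_measures (apply_bcontfun g)"
proof -
  have \<nu>p: "\<nu> k \<in> prob_measures euclidean" for k
    using \<nu> by (rule invariant_measures_prob)
  have meas: "apply_bcontfun h \<in> measurable m borel" if "m \<in> prob_measures euclidean"
    for m :: "'a measure" and h :: "'a \<Rightarrow>\<^sub>C 'a"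
    using borel_measurable_continuous_onI[OF continuous_on_apply_bcontfun]
    by (simp cong: measurable_cong_sets add: prob_measures_euclideanD(2)[OF that])
  have intd: "(\<integral>x. \<phi> x \<partial>distr m borel (apply_bcontfun h)) = (\<integral>x. \<phi> (h x) \<partial>m)"
    if "m \<in> prob_measures euclidean" "continuous_on UNIV \<phi>"
    for m :: "'a measure" and h :: "'a \<Rightarrow>\<^sub>C 'a" and \<phi> :: "'a \<Rightarrow> real"
    by (rule integral_distr[OF meas[OF that(1)] borel_measurable_continuous_onI[OF that(2)]])
  have dist\<nu>': "distr \<nu>' borel (apply_bcontfun g) \<in> prob_measures euclidean"
    using prob_space.prob_space_distr[OF prob_measures_euclideanD(1)[OF \<nu>'] meas[OF \<nu>']]
    by (simp add: prob_measures_euclidean)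
  have eq: "(\<integral>x. \<phi> (g x) \<partial>\<nu>') = (\<integral>x. \<phi> x \<partial>\<nu>')" if \<phi>: "continuous_on UNIV \<phi>" for \<phi> :: "'a \<Rightarrow> real"
  proof (rule LIMSEQ_unique)
    have \<phi>h: "continuous_on UNIV (\<lambda>x. \<phi> (apply_bcontfun h x))" for h :: "'a \<Rightarrow>\<^sub>C 'a"
      by (rule continuous_on_compose2[OF \<phi> continuous_on_apply_bcontfun]) simp
    show "(\<lambda>k. \<integral>x. \<phi> (g x) \<partial>\<nu> k) \<longlonglongrightarrow> (\<integral>x. \<phi> (g x) \<partial>\<nu>')"
      by (rule lim[OF \<phi>h])
    have "(\<lambda>k. (\<integral>x. \<phi> (g x) \<partial>\<nu> k) - (\<integral>x. \<phi> x \<partial>\<nu> k)) \<longlonglongrightarrow> 0"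
    proof (rule LIMSEQ_I)
      fix e :: real assume "e > 0"
      have "uniformly_continuous_on UNIV \<phi>"
        by (rule compact_uniformly_continuous[OF \<phi> assms(1)])
      then obtain d where d: "d > 0" "\<And>x y. dist y x < d \<Longrightarrow> dist (\<phi> y) (\<phi> x) < e / 2"
        using uniformly_continuous_onE[OF _ half_gt_zero[OF \<open>e > 0\<close>]] by (metis UNIV_I)
      obtain k0 where k0: "\<And>k. k \<ge> k0 \<Longrightarrow> dist (G k) g < d"
        using tendstoD[OF assms(2) d(1)] unfolding eventually_sequentially by blast
      have "norm ((\<integral>x. \<phi> (g x) \<partial>\<nu> k) - (\<integral>x. \<phi> x \<partial>\<nu> k) - 0) < e" if "k \<ge> k0" for k
      proof -
        interpret prob_space "\<nu> k" by (rule prob_measures_euclideanD(1)[OF \<nu>p])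
        note int = integrable_prob_measures_euclidean[OF assms(1) \<nu>p \<phi>h]
        have "(\<integral>x. \<phi> x \<partial>\<nu> k) = (\<integral>x. \<phi> (G k x) \<partial>\<nu> k)"
          using intd[OF \<nu>p \<phi>, of k "G k"] \<nu>[of k] by (simp add: invariant_measures_def)
        then have "(\<integral>x. \<phi> (g x) \<partial>\<nu> k) - (\<integral>x. \<phi> x \<partial>\<nu> k) = (\<integral>x. \<phi> (g x) - \<phi> (G k x) \<partial>\<nu> k)"
          using Bochner_Integration.integral_diff[OF int int] by simp
        also have "norm \<dots> \<le> (\<integral>x. norm (\<phi> (g x) - \<phi> (G k x)) \<partial>\<nu> k)"
          by (rule integral_norm_bound)
        also have "\<dots> \<le> (\<integral>x. e / 2 \<partial>\<nu> k)"
        proof (rule integral_mono)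
          show "integrable (\<nu> k) (\<lambda>x. norm (\<phi> (g x) - \<phi> (G k x)))"
            using int by (intro integrable_norm Bochner_Integration.integrable_diff)
          fix x
          have "dist (g x) (G k x) < d"
            using dist_fun_lt_imp_dist_val_lt[OF k0[OF that]] by (simp add: dist_commute)
          from d(2)[OF this] show "norm (\<phi> (g x) - \<phi> (G k x)) \<le> e / 2"
            by (simp add: dist_real_def)
        qed simp
        also have "\<dots> < e" using \<open>e > 0\<close> by (simp add: prob_space)
        finally show ?thesis by simp
      qed
      then show "\<exists>no. \<forall>n\<ge>no. norm ((\<integral>x. \<phi> (g x) \<partial>\<nu> n) - (\<integral>x. \<phi> x \<partial>\<nu> n) - 0) < e" by blast
    qed
    from tendsto_add[OF this lim[OF \<phi>]]
    show "(\<lambda>k. \<integral>x. \<phi> (g x) \<partial>\<nu> k) \<longlonglongrightarrow> (\<integral>x. \<phi> x \<partial>\<nu>')" by simp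
  qed
  obtain \<phi> :: "nat \<Rightarrow> 'a \<Rightarrow> real" where \<phi>: "\<forall>i. continuous_on UNIV (\<phi> i)"
    and sep: "\<forall>M\<in>prob_measures euclidean. \<forall>N\<in>prob_measures euclidean.
       (\<forall>i. (\<integral>x. \<phi> i x \<partial>M) = (\<integral>x. \<phi> i x \<partial>N)) \<longrightarrow> M = N"
    using prob_measures_separating_sequence[OF assms(1)] by (elim exE conjE) (rule that)
  have "(\<integral>x. \<phi> i x \<partial>distr \<nu>' borel (apply_bcontfun g)) = (\<integral>x. \<phi> i x \<partial>\<nu>')" for i
    using intd[OF \<nu>' \<phi>[rule_format]] eq[OF \<phi>[rule_format]] by simp
  then have "distr \<nu>' borel (apply_bcontfun g) = \<nu>'"
    by (intro sep[rule_format] dist\<nu>' \<nu>')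
  then show ?thesis using \<nu>' by (simp add: invariant_measures_def)
qed

text \<open>Weak compactness extracts a limit of the witnessing measures; it is invariant for the
  limit map, and the nonstrict bound survives the limit.\<close>

lemma closed_invariant_measure_near:
  fixes \<phi> :: "nat \<Rightarrow> 'a::metric_space \<Rightarrow> real"
  assumes "compact (UNIV :: 'a set)" and cont: "\<And>i. continuous_on UNIV (\<phi> i)"
  shows "closed {g :: 'a \<Rightarrow>\<^sub>C 'a. \<exists>\<nu>\<in>invariant_measures (apply_bcontfun g).
           \<forall>i<p. \<bar>(\<integral>x. \<phi> i x \<partial>\<nu>) - a i\<bar> \<le> \<delta>}"
    (is "closed ?S")
  unfolding closed_sequential_limits
proof (intro allI impI)
  fix G and g :: "'a \<Rightarrow>\<^sub>C 'a"
  assume G: "(\<forall>k. G k \<in> ?S) \<and> G \<longlonglongrightarrow> g"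
  then have "\<forall>k. \<exists>\<nu>. \<nu> \<in> invariant_measures (apply_bcontfun (G k)) \<and>
      (\<forall>i<p. \<bar>(\<integral>x. \<phi> i x \<partial>\<nu>) - a i\<bar> \<le> \<delta>)"
    by blast
  then obtain \<nu> where \<nu>: "\<And>k. \<nu> k \<in> invariant_measures (apply_bcontfun (G k))"
    and near: "\<And>k i. i < p \<Longrightarrow> \<bar>(\<integral>x. \<phi> i x \<partial>\<nu> k) - a i\<bar> \<le> \<delta>"
    by metis
  obtain r \<nu>' where r: "strict_mono r" and \<nu>': "\<nu>' \<in> prob_measures euclidean"
    and lim: "\<And>\<phi> :: 'a \<Rightarrow> real. continuous_on UNIV \<phi> \<Longrightarrow>
       (\<lambda>k. \<integral>x. \<phi> x \<partial>\<nu> (r k)) \<longlonglongrightarrow> (\<integral>x. \<phi> x \<partial>\<nu>')"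
    by (rule weak_sequential_compactness[OF assms(1) invariant_measures_prob[OF \<nu>]]) (rule that)
  have "(\<lambda>k. G (r k)) \<longlonglongrightarrow> g"
    using LIMSEQ_subseq_LIMSEQ[of G g r] G r by (simp add: o_def)
  then have "\<nu>' \<in> invariant_measures (apply_bcontfun g)"
    by (rule invariant_measures_limit[OF assms(1) _ \<nu> \<nu>' lim])
  moreover have "\<bar>(\<integral>x. \<phi> i x \<partial>\<nu>') - a i\<bar> \<le> \<delta>" if "i < p" for i
  proof (rule tendsto_upperbound)
    show "(\<lambda>k. \<bar>(\<integral>x. \<phi> i x \<partial>\<nu> (r k)) - a i\<bar>) \<longlonglongrightarrow> \<bar>(\<integral>x. \<phi> i x \<partial>\<nu>') - a i\<bar>"
      by (intro tendsto_intros lim cont)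
  qed (use near[OF that] in auto)
  ultimately show "g \<in> ?S" by blast
qed

section \<open>Stability of orbit averages under perturbation of the map\<close>

lemma tendsto_funpow_bcontfun:
  fixes g :: "'a::metric_space \<Rightarrow>\<^sub>C 'a"
  assumes "G \<longlonglongrightarrow> g"
  shows "(\<lambda>k. (apply_bcontfun (G k) ^^ j) x) \<longlonglongrightarrow> (apply_bcontfun g ^^ j) x"
proof (induction j)
  case (Suc j)
  let ?y = "\<lambda>k. (apply_bcontfun (G k) ^^ j) x" and ?z = "(apply_bcontfun g ^^ j) x"
  \<comment> \<open>The error at the next iterate is split at \<open>g (?y k)\<close>: the sup
    distance bounds the change of map, and continuity of \<open>g\<close> handles the change of
    point.\<close>
  have lim: "(\<lambda>k. dist (G k) g + dist (g (?y k)) (g ?z)) \<longlonglongrightarrow> 0 + 0"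
  proof (rule tendsto_add)
    show "(\<lambda>k. dist (G k) g) \<longlonglongrightarrow> 0" by (rule iffD1[OF tendsto_dist_iff assms])
    have "(\<lambda>k. g (?y k)) \<longlonglongrightarrow> g ?z"
      by (rule continuous_on_tendsto_compose[OF continuous_on_apply_bcontfun[of UNIV] Suc]) auto
    then show "(\<lambda>k. dist (g (?y k)) (g ?z)) \<longlonglongrightarrow> 0" by (rule iffD1[OF tendsto_dist_iff])
  qed
  have bound: "dist (G k (?y k)) (g ?z) \<le> dist (G k) g + dist (g (?y k)) (g ?z)" for k
    using dist_triangle[of "G k (?y k)" "g ?z" "g (?y k)"] dist_bounded[of "G k" "?y k" g]
    by linarith
  have "(\<lambda>k. dist (G k (?y k)) (g ?z)) \<longlonglongrightarrow> 0"
    by (rule tendsto_sandwich[OF _ _ tendsto_const lim[unfolded add_0]]) (simp_all add: bound)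
  then show ?case unfolding funpow.simps o_apply by (rule iffD2[OF tendsto_dist_iff])
qed simp

lemma open_Birkhoff_near:
  fixes \<phi> :: "nat \<Rightarrow> 'a::topological_space \<Rightarrow> real" and f :: "'a \<Rightarrow> 'a"
  assumes "\<And>i. continuous_on UNIV (\<phi> i)" "continuous_on UNIV f"
  shows "open {x. \<forall>i<p. \<bar>(\<Sum>j<n. \<phi> i ((f ^^ j) x)) / real n - a i\<bar> < \<delta>}"
proof -
  have "open (\<Inter>i\<in>{..<p}. {x. \<bar>(\<Sum>j<n. \<phi> i ((f ^^ j) x)) / real n - a i\<bar> < \<delta>})"
    by (intro open_INT open_Collect_less continuous_on_rabs continuous_on_diff continuous_on_const
        continuous_on_Birkhoff_average assms ballI) auto
  also have "(\<Inter>i\<in>{..<p}. {x. \<bar>(\<Sum>j<n. \<phi> i ((f ^^ j) x)) / real n - a i\<bar> < \<delta>}) =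
      {x. \<forall>i<p. \<bar>(\<Sum>j<n. \<phi> i ((f ^^ j) x)) / real n - a i\<bar> < \<delta>}" by auto
  finally show ?thesis .
qed

text \<open>At each point of \<open>S g\<close> the strict inequalities persist for
  \<open>G k\<close> with \<open>k\<close> large. So \<open>S g\<close> lies in the lower limit of
  the sets \<open>S (G k)\<close>, whose measure is at most any common bound \<open>c\<close> of
  theirs; hence the complementary set of maps is sequentially closed.\<close>

lemma open_Birkhoff_near_probability:
  fixes \<phi> :: "nat \<Rightarrow> 'a::metric_space \<Rightarrow> real"
  assumes \<mu>: "\<mu> \<in> prob_measures euclidean" and cont: "\<And>i. continuous_on UNIV (\<phi> i)"
  shows "open {g :: 'a \<Rightarrow>\<^sub>C 'a. c <
    measure \<mu> {x. \<forall>i<p. \<bar>(\<Sum>j<n. \<phi> i ((apply_bcontfun g ^^ j) x)) / real n - a i\<bar> < \<delta>}}"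
proof -
  interpret prob_space \<mu> by (rule prob_measures_euclideanD(1)[OF \<mu>])
  define S where "S g = {x. \<forall>i<p. \<bar>(\<Sum>j<n. \<phi> i ((apply_bcontfun g ^^ j) x)) / real n - a i\<bar> < \<delta>}"
    for g :: "'a \<Rightarrow>\<^sub>C 'a"
  have S [measurable]: "S g \<in> sets \<mu>" for g
    unfolding S_def prob_measures_euclideanD(2)[OF \<mu>]
    by (intro borel_open open_Birkhoff_near cont continuous_on_apply_bcontfun)
  have "closed {g. measure \<mu> (S g) \<le> c}"
    unfolding closed_sequential_limits
  proof (intro allI impI)
    fix G g assume G: "(\<forall>k. G k \<in> {g. measure \<mu> (S g) \<le> c}) \<and> G \<longlonglongrightarrow> g"
    \<comment> \<open>These tail intersections increase with \<open>m\<close>, and each lies in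
      \<open>S (G m)\<close>, so continuity from below preserves the bound \<open>c\<close>.\<close>
    define T where "T m = (\<Inter>k\<in>{m..}. S (G k))" for m
    have T: "T m \<in> sets \<mu>" for m
      unfolding T_def by (intro sets.countable_INT) auto
    have "S g \<subseteq> (\<Union>m. T m)"
    proof
      fix x assume x: "x \<in> S g"
      have "\<forall>\<^sub>F k in sequentially. x \<in> S (G k)"
      proof -
        have "\<forall>\<^sub>F k in sequentially.
            \<bar>(\<Sum>j<n. \<phi> i ((apply_bcontfun (G k) ^^ j) x)) / real n - a i\<bar> < \<delta>" if "i < p" for i
        proof (rule order_tendstoD(2))
          have "(\<lambda>k. \<phi> i ((apply_bcontfun (G k) ^^ j) x)) \<longlonglongrightarrow> \<phi> i ((apply_bcontfun g ^^ j) x)" for j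
            using G by (intro continuous_on_tendsto_compose[OF cont tendsto_funpow_bcontfun]) auto
          then show "(\<lambda>k. \<bar>(\<Sum>j<n. \<phi> i ((apply_bcontfun (G k) ^^ j) x)) / real n - a i\<bar>)
              \<longlonglongrightarrow> \<bar>(\<Sum>j<n. \<phi> i ((apply_bcontfun g ^^ j) x)) / real n - a i\<bar>"
            unfolding divide_inverse by (intro tendsto_intros)
        qed (use x that in \<open>simp add: S_def\<close>)
        then have "\<forall>\<^sub>F k in sequentially. \<forall>i\<in>{..<p}.
            \<bar>(\<Sum>j<n. \<phi> i ((apply_bcontfun (G k) ^^ j) x)) / real n - a i\<bar> < \<delta>"
          by (intro eventually_ball_finite) auto
        then show ?thesis unfolding S_def by eventually_elim auto
      qed
      then show "x \<in> (\<Union>m. T m)"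
        unfolding T_def eventually_sequentially by auto
    qed
    then have "measure \<mu> (S g) \<le> measure \<mu> (\<Union>m. T m)"
      using T by (intro finite_measure_mono sets.countable_UN) auto
    also have "\<dots> \<le> c"
    proof (rule LIMSEQ_le_const2)
      have "incseq T" unfolding T_def by (intro incseq_SucI) auto
      then show "(\<lambda>m. measure \<mu> (T m)) \<longlonglongrightarrow> measure \<mu> (\<Union>m. T m)"
        using T by (intro finite_Lim_measure_incseq) auto
      have "measure \<mu> (T m) \<le> c" for m
      proof -
        have "measure \<mu> (T m) \<le> measure \<mu> (S (G m))"
          unfolding T_def by (intro finite_measure_mono S) auto
        also have "\<dots> \<le> c" using G by simp
        finally show ?thesis .
      qed
      then show "\<exists>N. \<forall>m\<ge>N. measure \<mu> (T m) \<le> c" by blast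
    qed
    finally show "g \<in> {g. measure \<mu> (S g) \<le> c}" by simp
  qed
  then have "open (- {g. measure \<mu> (S g) \<le> c})" by (rule open_Compl)
  also have "- {g. measure \<mu> (S g) \<le> c} = {g. c < measure \<mu> (S g)}" by auto
  finally show ?thesis unfolding S_def .
qed

section \<open>Generic maximal oscillation\<close>

text \<open>Testing convergence of the empirical laws to the Dirac mass at \<open>\<nu>\<close>
  against a continuous bump gives integrals tending to 1. The bump is at most the indicator of the
  desired set of points, so that set has probability above \<open>c\<close> for some late
  perturbation.\<close>

lemma bifurcation_measure_approximation:
  fixes \<phi> :: "nat \<Rightarrow> 'a::metric_space \<Rightarrow> real"
  assumes \<mu>: "\<mu> \<in> prob_measures euclidean" and cont: "\<And>i. continuous_on UNIV (\<phi> i)"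
    and \<nu>: "\<nu> \<in> bifurcation_measures \<mu> \<Lambda> f"
    and near: "\<And>i. i < p \<Longrightarrow> \<bar>(\<integral>x. \<phi> i x \<partial>\<nu>) - a i\<bar> \<le> \<delta>"
    and "\<delta> > 0" "c < 1" and V: "openin \<Lambda> V" "f \<in> V"
  shows "\<exists>g\<in>V. \<exists>n\<ge>N. n > 0 \<and> c < measure \<mu>
    {x. \<forall>i<p. \<bar>(\<Sum>j<n. \<phi> i ((apply_bcontfun g ^^ j) x)) / real n - a i\<bar> < 2 * \<delta>}"
proof -
  interpret prob_space \<mu> by (rule prob_measures_euclideanD(1)[OF \<mu>])
  let ?W = "weak_star (euclidean :: 'a topology)"
  obtain F n where F: "limitin \<Lambda> F f sequentially" and n: "filterlim n at_top sequentially"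
    and law: "limitin (weak_star ?W) (\<lambda>k. empirical_law \<mu> (apply_bcontfun (F k)) (n k))
        (return (borel_of ?W) \<nu>) sequentially"
    and \<nu>p: "\<nu> \<in> prob_measures euclidean"
    using \<nu> unfolding bifurcation_measures_def bifurcation_set_def bifurcates_toward_def by blast
  \<comment> \<open>The bump is 1 at \<open>\<nu>\<close> and positive only where the summed
    deviations of the first \<open>p\<close> integrals from those of \<open>\<nu>\<close> are below
    \<open>\<delta>\<close>.\<close>
  define \<Phi> where "\<Phi> m = max 0 (1 - (\<Sum>i<p. \<bar>(\<integral>x. \<phi> i x \<partial>m) - (\<integral>x. \<phi> i x \<partial>\<nu>)\<bar>) * inverse \<delta>)" for m
  have \<Phi>: "continuous_map ?W euclideanreal \<Phi>"
    unfolding \<Phi>_def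
    by (intro continuous_map_real_max continuous_map_diff continuous_map_real_mult
        continuous_map_sum continuous_map_real_abs continuous_map_const[THEN iffD2]
        continuous_map_weak_star_integral) (simp_all add: cont)
  have \<Phi>m: "\<Phi> \<in> borel_measurable M" if "space M = prob_measures euclidean" "sets M = sets (borel_of ?W)" for M
    using measurable_borel_of[OF \<Phi>, of M] that
    by (simp cong: measurable_cong_sets)
  have "limitin euclideanreal ((\<lambda>M. \<integral>m. \<Phi> m \<partial>M) \<circ> (\<lambda>k. empirical_law \<mu> (apply_bcontfun (F k)) (n k)))
      (\<integral>m. \<Phi> m \<partial>return (borel_of ?W) \<nu>) sequentially"
    by (rule continuous_map_limit[OF continuous_map_weak_star_integral[OF \<Phi>] law])
  also have "(\<integral>m. \<Phi> m \<partial>return (borel_of ?W) \<nu>) = 1"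
    using \<nu>p \<Phi>m[of "borel_of ?W"] by (subst integral_return) (auto simp: \<Phi>_def)
  finally have "(\<lambda>k. \<integral>m. \<Phi> m \<partial>empirical_law \<mu> (apply_bcontfun (F k)) (n k)) \<longlonglongrightarrow> 1"
    by (simp add: o_def)
  from order_tendstoD(1)[OF this \<open>c < 1\<close>]
  have "\<forall>\<^sub>F k in sequentially. c < (\<integral>m. \<Phi> m \<partial>empirical_law \<mu> (apply_bcontfun (F k)) (n k))" .
  moreover have "\<forall>\<^sub>F k in sequentially. F k \<in> V"
    using F V unfolding limitin_def by blast
  \<comment> \<open>The maximum with 1 keeps the time positive, where empirical measures are
    probability measures.\<close>
  moreover have "\<forall>\<^sub>F k in sequentially. max N 1 \<le> n k"
    using n unfolding filterlim_at_top by blast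
  ultimately have "\<forall>\<^sub>F k in sequentially. c < (\<integral>m. \<Phi> m \<partial>empirical_law \<mu> (apply_bcontfun (F k)) (n k))
      \<and> F k \<in> V \<and> max N 1 \<le> n k"
    by (intro eventually_conj)
  then obtain k where k: "c < (\<integral>m. \<Phi> m \<partial>empirical_law \<mu> (apply_bcontfun (F k)) (n k))"
    "F k \<in> V" "max N 1 \<le> n k"
    using eventually_happens'[OF sequentially_bot] by blast
  then have pos: "n k > 0" by simp
  define S where "S = {x. \<forall>i<p. \<bar>(\<Sum>j<n k. \<phi> i ((apply_bcontfun (F k) ^^ j) x)) / real (n k) - a i\<bar> < 2 * \<delta>}"
  have S: "S \<in> sets \<mu>"
    unfolding S_def prob_measures_euclideanD(2)[OF \<mu>]
    by (intro borel_open open_Birkhoff_near cont continuous_on_apply_bcontfun)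
  have emp: "empirical (F k) (n k) \<in> measurable \<mu> (borel_of ?W)"
    using continuous_map_empirical[OF pos continuous_on_apply_bcontfun]
    by (rule measurable_borel_of)
      (simp_all add: prob_measures_euclideanD(2,3)[OF \<mu>])
  \<comment> \<open>Where the bump is nonzero, each integral is within \<open>\<delta>\<close> of
    that for \<open>\<nu>\<close>, which is itself within \<open>\<delta>\<close> of
    \<open>a i\<close>; hence the radius \<open>2 * \<delta>\<close>.\<close>
  have le: "\<Phi> (empirical (F k) (n k) x) \<le> indicator S x" for x
  proof (cases "\<Phi> (empirical (F k) (n k) x) = 0")
    case False
    let ?m = "empirical (F k) (n k) x"
    have "(\<Sum>i<p. \<bar>(\<integral>x. \<phi> i x \<partial>?m) - (\<integral>x. \<phi> i x \<partial>\<nu>)\<bar>) * inverse \<delta> < 1"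
      using False unfolding \<Phi>_def by (auto simp: max_def split: if_splits)
    then have sum: "(\<Sum>i<p. \<bar>(\<integral>x. \<phi> i x \<partial>?m) - (\<integral>x. \<phi> i x \<partial>\<nu>)\<bar>) < \<delta>"
      using \<open>\<delta> > 0\<close> by (simp add: divide_inverse[symmetric])
    have "x \<in> S"
      unfolding S_def
    proof (intro CollectI allI impI)
      fix i assume i: "i < p"
      have "\<bar>(\<integral>x. \<phi> i x \<partial>?m) - (\<integral>x. \<phi> i x \<partial>\<nu>)\<bar> \<le> (\<Sum>i<p. \<bar>(\<integral>x. \<phi> i x \<partial>?m) - (\<integral>x. \<phi> i x \<partial>\<nu>)\<bar>)"
        using i by (intro member_le_sum) auto
      with sum near[OF i] have "\<bar>(\<integral>x. \<phi> i x \<partial>?m) - a i\<bar> < 2 * \<delta>" by linarith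
      then show "\<bar>(\<Sum>j<n k. \<phi> i ((apply_bcontfun (F k) ^^ j) x)) / real (n k) - a i\<bar> < 2 * \<delta>"
        by (simp add: integral_empirical[OF pos cont])
    qed
    moreover have "\<Phi> ?m \<le> 1"
      using \<open>\<delta> > 0\<close> unfolding \<Phi>_def by (simp add: sum_nonneg)
    ultimately show ?thesis by simp
  qed simp
  have "(\<integral>m. \<Phi> m \<partial>empirical_law \<mu> (apply_bcontfun (F k)) (n k)) = (\<integral>x. \<Phi> (empirical (F k) (n k) x) \<partial>\<mu>)"
    unfolding empirical_law_def by (rule integral_distr[OF emp]) (simp add: \<Phi>m)
  also have "\<dots> \<le> (\<integral>x. indicator S x \<partial>\<mu>)"
  proof (rule integral_mono)
    have "\<Phi> (empirical (F k) (n k) x) \<ge> 0" for x unfolding \<Phi>_def by simp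
    then have "norm (\<Phi> (empirical (F k) (n k) x)) \<le> 1" for x
      using le[of x] indicator_le_1[of S x] by (simp add: order_trans[OF le])
    then show "integrable \<mu> (\<lambda>x. \<Phi> (empirical (F k) (n k) x))"
      using measurable_compose[OF emp \<Phi>m[of "borel_of ?W"]]
      by (intro integrable_const_bound[of _ 1]) auto
    show "integrable \<mu> (indicator S :: 'a \<Rightarrow> real)"
      using S by (intro integrable_const_bound[of _ 1]) auto
  qed (rule le)
  also have "\<dots> = measure \<mu> S" using S by simp
  finally have "c < measure \<mu> S" using k(1) by simp
  then show ?thesis
    using k(2,3) pos unfolding S_def by (intro bexI[of _ "F k"] exI[of _ "n k"]) auto
qed

text \<open>Using \<open>large\<close> at every \<open>k \<ge> N\<close> bounds the probability of
  the union over \<open>n \<ge> N\<close> below by 1 - 1/(k+1) for all such \<open>k\<close>, so it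
  is 1. Intersecting over the countably many \<open>N\<close> gives infinitely many visits.\<close>

lemma (in prob_space) AE_frequently:
  assumes S: "\<And>n. S n \<in> events"
    and large: "\<And>N. \<exists>n\<ge>N. prob (S n) > 1 - 1 / real (Suc N)"
  shows "AE x in M. \<exists>\<^sub>F n in sequentially. x \<in> S n"
proof -
  have "AE x in M. x \<in> (\<Union>n\<in>{N..}. S n)" for N
  proof -
    have U: "(\<Union>n\<in>{N..}. S n) \<in> events" using S by auto
    have "1 - 1 / real (Suc k) \<le> prob (\<Union>n\<in>{N..}. S n)" if "k \<ge> N" for k
    proof -
      obtain n where n: "n \<ge> k" "prob (S n) > 1 - 1 / real (Suc k)" using large by blast
      have "prob (S n) \<le> prob (\<Union>n\<in>{N..}. S n)"
        using n(1) that by (intro finite_measure_mono U UN_upper) simp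
      with n show ?thesis by linarith
    qed
    moreover have "(\<lambda>k. 1 - 1 / real (Suc k)) \<longlonglongrightarrow> 1 - 0"
      by (intro tendsto_diff tendsto_const LIMSEQ_Suc[OF lim_1_over_n])
    ultimately have "1 - 0 \<le> prob (\<Union>n\<in>{N..}. S n)"
      by (intro LIMSEQ_le_const2) blast+
    then have "prob (\<Union>n\<in>{N..}. S n) = 1"
      using prob_le_1[of "\<Union>n\<in>{N..}. S n"] by linarith
    then show ?thesis by (rule AE_prob_1)
  qed
  then have "AE x in M. \<forall>N. x \<in> (\<Union>n\<in>{N..}. S n)"
    by (subst AE_all_countable) blast
  then show ?thesis
    by eventually_elim (auto simp: frequently_sequentially)
qed

theorem theorem1p19:
  fixes \<mu> :: "'a::metric_space measure"
    and \<Lambda> :: "('a \<Rightarrow>\<^sub>C 'a) topology"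
    and D :: "('a \<Rightarrow>\<^sub>C 'a) set"
  assumes "compact (UNIV :: 'a set)"
    and "\<mu> \<in> prob_measures euclidean"
    and "Baire_space \<Lambda>"
    and "finer_than_C0 \<Lambda>"
    and "dense_in \<Lambda> D"
    and "\<And>f. f \<in> D \<Longrightarrow> bifurcation_measures \<mu> \<Lambda> f = invariant_measures (apply_bcontfun f)"
  shows "Baire_generic \<Lambda> (\<lambda>g. maximal_oscillation \<mu> (apply_bcontfun g))"
proof -
  interpret prob_space \<mu> by (rule prob_measures_euclideanD(1)[OF assms(2)])
  obtain \<phi> :: "nat \<Rightarrow> 'a \<Rightarrow> real" where \<phi>: "\<forall>i. continuous_on UNIV (\<phi> i)"
    and sep: "\<forall>M\<in>prob_measures euclidean. \<forall>N\<in>prob_measures euclidean.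
       (\<forall>i. (\<integral>x. \<phi> i x \<partial>M) = (\<integral>x. \<phi> i x \<partial>N)) \<longrightarrow> M = N"
    using prob_measures_separating_sequence[OF assms(1)] by (elim exE conjE) (rule that)
  have cont: "continuous_on UNIV (\<phi> i)" for i using \<phi> by simp
  define S where "S g l m n = {x. \<forall>i<length l.
      \<bar>(\<Sum>j<n. \<phi> i ((apply_bcontfun g ^^ j) x)) / real n - of_rat (l ! i)\<bar> < 2 * (1 / real (Suc m))}"
    for g :: "'a \<Rightarrow>\<^sub>C 'a" and l :: "rat list" and m n :: nat
  define A where "A l m = {g :: 'a \<Rightarrow>\<^sub>C 'a. \<exists>\<nu>\<in>invariant_measures (apply_bcontfun g).
      \<forall>i<length l. \<bar>(\<integral>x. \<phi> i x \<partial>\<nu>) - of_rat (l ! i)\<bar> \<le> 1 / real (Suc m)}"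
    for l :: "rat list" and m :: nat
  \<comment> \<open>\<open>N\<close> controls both the lateness of the time and the exceptional
    probability, matching the hypothesis of \<open>AE_frequently\<close>.\<close>
  define Q where "Q l m N = {g :: 'a \<Rightarrow>\<^sub>C 'a. \<exists>n\<ge>N. n > 0 \<and> 1 - 1 / real (Suc N) < prob (S g l m n)}"
    for l :: "rat list" and m N :: nat
  define H where "H t = (case from_nat t of (l, m, N) \<Rightarrow> (Q l m N \<union> - A l m) \<inter> topspace \<Lambda>)" for t
  have S: "S g l m n \<in> events" for g l m n
    unfolding S_def prob_measures_euclideanD(2)[OF assms(2)]
    by (intro borel_open open_Birkhoff_near cont continuous_on_apply_bcontfun)
  have "open (- A l m)" for l m
    unfolding A_def by (intro open_Compl closed_invariant_measure_near assms(1) cont)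
  moreover have "open (Q l m N)" for l m N
  proof -
    have "Q l m N = (\<Union>n\<in>{n. N \<le> n \<and> n > 0}. {g. 1 - 1 / real (Suc N) < prob (S g l m n)})"
      unfolding Q_def by auto
    then show ?thesis
      unfolding S_def
      by (simp only:) (intro open_UN ballI open_Birkhoff_near_probability assms(2) cont)
  qed
  ultimately have "open (Q l m N \<union> - A l m)" for l m N by (intro open_Un)
  then have openH: "openin \<Lambda> (H t)" for t
    using assms(4) unfolding finer_than_C0_def H_def by (simp split: prod.split)
  have denseH: "dense_in \<Lambda> (H t)" for t
    unfolding dense_in_def dense_intersects_open
  proof (intro conjI allI impI)
    show "H t \<subseteq> topspace \<Lambda>" using openin_subset[OF openH] .
    fix V assume V: "openin \<Lambda> V \<and> V \<noteq> {}"
    obtain l :: "rat list" and m N :: nat where t: "from_nat t = (l, m, N)"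
      by (rule prod_cases3)
    \<comment> \<open>If \<open>V\<close> is not inside \<open>A l m\<close>, a map of
      \<open>V\<close> outside it already lies in \<open>H t\<close>. Otherwise a map of
      \<open>D\<close> in \<open>V\<close> has an invariant measure near \<open>l\<close>, which by
      hypothesis is a bifurcation measure, and a perturbation within \<open>V\<close> lies in
      \<open>Q l m N\<close>.\<close>
    show "H t \<inter> V \<noteq> {}"
    proof (cases "V \<subseteq> A l m")
      case True
      have "D \<inter> V \<noteq> {}"
        using assms(5) V unfolding dense_in_def dense_intersects_open by blast
      then obtain f where f: "f \<in> D" "f \<in> V" by blast
      then obtain \<nu> where \<nu>: "\<nu> \<in> invariant_measures (apply_bcontfun f)"
        "\<And>i. i < length l \<Longrightarrow> \<bar>(\<integral>x. \<phi> i x \<partial>\<nu>) - of_rat (l ! i)\<bar> \<le> 1 / real (Suc m)"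
        using True unfolding A_def by blast
      have "\<exists>g\<in>V. g \<in> Q l m N"
        using bifurcation_measure_approximation[OF assms(2) cont, where \<nu> = \<nu> and \<Lambda> = \<Lambda> and f = f
            and p = "length l" and a = "\<lambda>i. of_rat (l ! i)" and \<delta> = "1 / real (Suc m)"
            and c = "1 - 1 / real (Suc N)" and V = V and N = N] \<nu> f V
        unfolding assms(6)[OF f(1)] Q_def S_def by simp
      then show ?thesis
        using openin_subset[of \<Lambda> V] V unfolding H_def t by auto
    next
      case False
      then show ?thesis
        using openin_subset[of \<Lambda> V] V unfolding H_def t by auto
    qed
  qed
  have "maximal_oscillation \<mu> (apply_bcontfun g)" if g: "g \<in> (\<Inter>t. H t)" for g
  proof -
    have visits: "\<exists>n\<ge>N. n > 0 \<and> 1 - 1 / real (Suc N) < prob (S g l m n)" if "g \<in> A l m" for l m N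
    proof -
      have "g \<in> H (to_nat (l, m, N))" using g by blast
      with that show ?thesis unfolding H_def Q_def by simp
    qed
    have "AE x in \<mu>. g \<in> A l m \<longrightarrow> (\<exists>\<^sub>F n in sequentially. x \<in> S g l m n)" for l m
    proof (cases "g \<in> A l m")
      case True
      then have "AE x in \<mu>. \<exists>\<^sub>F n in sequentially. x \<in> S g l m n"
        using visits by (intro AE_frequently S) blast
      then show ?thesis by eventually_elim simp
    qed simp
    \<comment> \<open>The null sets are united over the countably many pairs of \<open>l\<close> and
      \<open>m\<close> before an invariant measure is chosen, since there may be uncountably many of
      those.\<close>
    then have "AE x in \<mu>. \<forall>l m. g \<in> A l m \<longrightarrow> (\<exists>\<^sub>F n in sequentially. x \<in> S g l m n)"
      by (subst AE_all_countable, intro allI, subst AE_all_countable) blast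
    then show ?thesis
      unfolding maximal_oscillation_def
    proof eventually_elim
      case (elim x)
      show ?case
      proof
        fix \<nu> assume \<nu>: "\<nu> \<in> invariant_measures (apply_bcontfun g)"
        show "accumulates_to (weak_star euclidean) (\<lambda>n. empirical (apply_bcontfun g) n x) \<nu>"
          unfolding accumulates_to_def
        proof (intro conjI allI impI)
          show "\<nu> \<in> topspace (weak_star euclidean)"
            using invariant_measures_prob[OF \<nu>] by simp
          fix U assume U: "openin (weak_star euclidean) U \<and> \<nu> \<in> U"
          obtain k where k: "\<And>m. m \<in> prob_measures euclidean \<Longrightarrow>
            (\<And>i. i < k \<Longrightarrow> \<bar>(\<integral>x. \<phi> i x \<partial>m) - (\<integral>x. \<phi> i x \<partial>\<nu>)\<bar> < 1 / real (Suc k)) \<Longrightarrow> m \<in> U"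
            using weak_star_neighbourhood[OF assms(1) cont sep, where U = U and \<nu> = \<nu>] U by blast
          \<comment> \<open>Membership in \<open>S\<close> costs 2/(m+1) and the rational
            approximation 1/(m+1); in total 3/(3k+4), which is below 1/(k+1).\<close>
          define m where "m = 3 * Suc k"
          have m: "3 * (1 / real (Suc m)) < 1 / real (Suc k)"
            unfolding m_def by (simp add: field_simps)
          have "\<exists>q :: rat. \<bar>(\<integral>x. \<phi> i x \<partial>\<nu>) - of_rat q\<bar> \<le> 1 / real (Suc m)" for i
          proof -
            obtain q where "(\<integral>x. \<phi> i x \<partial>\<nu>) < of_rat q" "of_rat q < (\<integral>x. \<phi> i x \<partial>\<nu>) + 1 / real (Suc m)"
              using of_rat_dense[of "\<integral>x. \<phi> i x \<partial>\<nu>" "(\<integral>x. \<phi> i x \<partial>\<nu>) + 1 / real (Suc m)"] by auto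
            then show ?thesis by (intro exI[of _ q]) linarith
          qed
          then obtain q where q: "\<And>i. \<bar>(\<integral>x. \<phi> i x \<partial>\<nu>) - of_rat (q i :: rat)\<bar> \<le> 1 / real (Suc m)"
            by metis
          define l where "l = map q [0..<k]"
          have l: "length l = k" "\<And>i. i < k \<Longrightarrow> l ! i = q i" by (simp_all add: l_def)
          have "g \<in> A l m"
            unfolding A_def using \<nu> q by (intro CollectI bexI[of _ \<nu>]) (auto simp: l)
          with elim have freq: "\<exists>\<^sub>F n in sequentially. x \<in> S g l m n" by blast
          \<comment> \<open>At time 0 the empirical measure is the zero measure, so that time is
            discarded.\<close>
          have "\<forall>\<^sub>F n in sequentially. x \<in> S g l m n \<longrightarrow> x \<in> S g l m n \<and> 0 < n"
            using eventually_gt_at_top[of "0 :: nat"] by eventually_elim simp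
          with freq have "\<exists>\<^sub>F n in sequentially. x \<in> S g l m n \<and> 0 < n"
            by (rule frequently_rev_mp)
          then show "\<exists>\<^sub>F n in sequentially. empirical (apply_bcontfun g) n x \<in> U"
          proof (rule frequently_elim1)
            fix n assume n: "x \<in> S g l m n \<and> 0 < n"
            show "empirical (apply_bcontfun g) n x \<in> U"
            proof (rule k)
              show "empirical (apply_bcontfun g) n x \<in> prob_measures euclidean"
                using n by (simp add: empirical_in_prob_measures)
              fix i assume i: "i < k"
              have "\<bar>(\<integral>y. \<phi> i y \<partial>empirical (apply_bcontfun g) n x) - of_rat (q i)\<bar> < 2 * (1 / real (Suc m))"
                using n i unfolding S_def by (simp add: l integral_empirical cont)
              with q[of i] m
              show "\<bar>(\<integral>y. \<phi> i y \<partial>empirical (apply_bcontfun g) n x) - (\<integral>y. \<phi> i y \<partial>\<nu>)\<bar> < 1 / real (Suc k)"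
                by linarith
            qed
          qed
        qed
      qed
    qed
  qed
  with openH denseH show ?thesis
    unfolding Baire_generic_def by blast
qed

end
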